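(* Let $(B^n,g_B)$, $(F^m,g_F)$ be semi-Riemannian manifolds, $f>0$ a smooth function on $B$, $g=\pi^*g_B+(f\circ\pi)^2\sigma^*g_F$ the warped product metric on $B\times F$, $\lambda\in\mathbb{R}$, $\theta\ge0$, and let $h=h_B\circ\pi$ with $h_B\in C^\infty(B)$. (a) Suppose $u=u_B\circ\pi$ with $u_B\in C^\infty(B)$. Then $(B^n\times_fF^m,g,h,u,\lambda)$ is a GRHS (with constant $\theta$) if and only if there is a constant $\mu$ such that all of the following hold: $$Ric_{g_B}-\frac{m}{f}Hess_{g_B}f+Hess_{g_B}h_B-\theta\,\nabla_{g_B}u_B\otimes\nabla_{g_B}u_B=\lambda g_B,$$ $$\Delta_\omega u_B=0\ \text{ in } B,\qquad \omega=h_B-m\log f,$$ $F$ is Einstein with $Ric_{g_F}=\mu g_F$, and $$f\Delta_{g_B}f+(m-1)|\nabla_{g_B}f|^2+\lambda f^2-f\,\nabla_{g_B}f(h_B)=\mu .$$ (b) Suppose $u=u_F\circ\sigma$ with $u_F\in C^\infty(F)$. Then $(B^n\times_fF^m,g,h,u,\lambda)$ is a GRHS (with constant $\theta$) if and only if there is a constant $\mu$ such that all of the following hold: $$Ric_{g_B}-\frac{m}{f}Hess_{g_B}f+Hess_{g_B}h_B=\lambda g_B,$$ $F$ is Einstein-harmonic with $$Ric_{g_F}-\theta\,\nabla_{g_F}u_F\otimes\nabla_{g_F}u_F=\mu g_F,\qquad \Delta_{g_F}u_F=0,$$ and $$f\Delta_{g_B}f+(m-1)|\nabla_{g_B}f|^2+\lambda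 f^2-f\,\nabla_{g_B}f(h_B)=\mu .$$
   Context: Here $\pi:B\times F\to B$ and $\sigma:B\times F\to F$ are the projections; $B\times_f F$ denotes $B\times F$ with the metric $g$. Let $(M,g)$ be a semi-Riemannian manifold, $u,h:M\to\mathbb{R}$ smooth functions, $\lambda\in\mathbb{R}$. One says that $(M,g,h,u,\lambda)$ is a gradient Ricci-harmonic soliton (GRHS) with constant $\theta\ge0$ if $$Ric_g+Hess\,h-\theta\,\nabla u\otimes\nabla u=\lambda g,\qquad \Delta_g u-g(\nabla u,\nabla h)=0,$$ where $(\nabla u\otimes\nabla u)(X,Y)=X(u)Y(u)$ and $\Delta_g u=\mathrm{tr}_gHess\,u$. $Ric_{g_B},Ric_{g_F}$ are the Ricci tensors of $B,F$; $|\nabla_{g_B}f|^2=g_B(\nabla_{g_B}f,\nabla_{g_B}f)$; $\nabla_{g_B}f(h_B)=g_B(\nabla_{g_B}f,\nabla_{g_B}h_B)$; and $\Delta_\omega=\Delta_{g_B}-g_B(\nabla_{g_B}\,\cdot\,,\nabla_{g_B}\omega)$. *)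

theory Defs
  imports "HOL-Analysis.Analysis"
begin

section \<open>Smooth maps between Euclidean spaces\<close>

fun Ck_on :: "nat \<Rightarrow> 'e::euclidean_space set \<Rightarrow> ('e \<Rightarrow> 'k::euclidean_space) \<Rightarrow> bool" where
  "Ck_on 0 S F \<longleftrightarrow> continuous_on S F"
| "Ck_on (Suc k) S F \<longleftrightarrow>
     (\<forall>x\<in>S. F differentiable (at x)) \<and> (\<forall>v. Ck_on k S (\<lambda>x. frechet_derivative F (at x) v))"

text \<open>Only used for open \<open>S\<close>, so that the derivatives do not depend on values outside \<open>S\<close>.\<close>

definition smooth_on :: "'e::euclidean_space set \<Rightarrow> ('e \<Rightarrow> 'k::euclidean_space) \<Rightarrow> bool" where
  "smooth_on S F \<longleftrightarrow> (\<forall>k. Ck_on k S F)"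


section \<open>Semi-Riemannian calculus on an open subset of a Euclidean space\<close>

text \<open>
  Here \<open>G x\<close> is the bilinear form at the point \<open>x\<close> and a vector \<open>v\<close> also stands for the constant
  (coordinate) vector field \<open>v\<close>. For \<open>v, w\<close> in \<open>Basis\<close> these are the classical component formulas
  in the coordinates of the standard basis.
\<close>

definition dder :: "('e::euclidean_space \<Rightarrow> 'k::euclidean_space) \<Rightarrow> 'e \<Rightarrow> 'e \<Rightarrow> 'k" where
  "dder F x v = frechet_derivative F (at x) v"

definition nondegenerate_form :: "('e::euclidean_space \<Rightarrow> 'e \<Rightarrow> real) \<Rightarrow> bool" where
  "nondegenerate_form b \<longleftrightarrow> (\<forall>v. (\<forall>w. b v w = 0) \<longrightarrow> v = 0)"

definition form_index :: "('e::euclidean_space \<Rightarrow> 'e \<Rightarrow> real) \<Rightarrow> nat" where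
  "form_index b = Max {dim W | W. subspace W \<and> (\<forall>w\<in>W. w \<noteq> 0 \<longrightarrow> b w w < 0)}"

text \<open>The vector that represents the linear functional \<open>L\<close> with respect to a nondegenerate form.\<close>

definition sharp :: "('e::euclidean_space \<Rightarrow> 'e \<Rightarrow> real) \<Rightarrow> ('e \<Rightarrow> real) \<Rightarrow> 'e" where
  "sharp b L = (THE z. \<forall>w. b z w = L w)"

text \<open>\<open>christoffel G x v w\<close> is the Levi-Civita derivative of \<open>w\<close> in direction \<open>v\<close>, given by the
  Koszul formula; the brackets of coordinate fields vanish.\<close>

definition christoffel :: "('e::euclidean_space \<Rightarrow> 'e \<Rightarrow> 'e \<Rightarrow> real) \<Rightarrow> 'e \<Rightarrow> 'e \<Rightarrow> 'e \<Rightarrow> 'e" where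
  "christoffel G x v w =
     sharp (G x) (\<lambda>z. (dder (\<lambda>y. G y w z) x v + dder (\<lambda>y. G y v z) x w - dder (\<lambda>y. G y v w) x z) / 2)"

text \<open>Sign convention: the curvature operator \<open>[\<nabla>\<^sub>v, \<nabla>\<^sub>w] - \<nabla>\<^bsub>[v,w]\<^esub>\<close> applied to \<open>z\<close>, and the Ricci
  tensor is the trace of \<open>z \<mapsto> R(z,v)w\<close> (positive on round spheres).\<close>

definition curvature :: "('e::euclidean_space \<Rightarrow> 'e \<Rightarrow> 'e \<Rightarrow> real) \<Rightarrow> 'e \<Rightarrow> 'e \<Rightarrow> 'e \<Rightarrow> 'e \<Rightarrow> 'e" where
  "curvature G x v w z =
     dder (\<lambda>y. christoffel G y w z) x v - dder (\<lambda>y. christoffel G y v z) x w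
     + christoffel G x v (christoffel G x w z) - christoffel G x w (christoffel G x v z)"

definition loc_ricci :: "('e::euclidean_space \<Rightarrow> 'e \<Rightarrow> 'e \<Rightarrow> real) \<Rightarrow> 'e \<Rightarrow> 'e \<Rightarrow> 'e \<Rightarrow> real" where
  "loc_ricci G x v w = (\<Sum>b\<in>Basis. curvature G x b v w \<bullet> b)"

definition loc_hess ::
  "('e::euclidean_space \<Rightarrow> 'e \<Rightarrow> 'e \<Rightarrow> real) \<Rightarrow> ('e \<Rightarrow> real) \<Rightarrow> 'e \<Rightarrow> 'e \<Rightarrow> 'e \<Rightarrow> real" where
  "loc_hess G U x v w = dder (\<lambda>y. dder U y w) x v - dder U x (christoffel G x v w)"

definition loc_grad :: "('e::euclidean_space \<Rightarrow> 'e \<Rightarrow> 'e \<Rightarrow> real) \<Rightarrow> ('e \<Rightarrow> real) \<Rightarrow> 'e \<Rightarrow> 'e" where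
  "loc_grad G U x = sharp (G x) (dder U x)"

text \<open>The trace of a bilinear form \<open>T\<close> with respect to \<open>b\<close>: the trace of the endomorphism \<open>A\<close>
  with \<open>b (A v) w = T v w\<close>.\<close>

definition metric_trace ::
  "('e::euclidean_space \<Rightarrow> 'e \<Rightarrow> real) \<Rightarrow> ('e \<Rightarrow> 'e \<Rightarrow> real) \<Rightarrow> real" where
  "metric_trace b T = (\<Sum>e\<in>Basis. sharp b (T e) \<bullet> e)"


section \<open>Smooth manifolds\<close>

type_synonym ('p, 'e) chart = "'p set \<times> ('p \<Rightarrow> 'e)"

text \<open>The values of the map of a chart outside the domain of the chart are irrelevant. The points
  of the manifold are the points of the topology; the dimension is \<open>DIM('e)\<close>.\<close>

record ('p, 'e) manifold =
  mtop :: "'p topology"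
  atlas :: "('p, 'e) chart set"

abbreviation carrier :: "('p, 'e) manifold \<Rightarrow> 'p set" where
  "carrier M \<equiv> topspace (mtop M)"

definition chart_inv :: "('p, 'e) chart \<Rightarrow> 'e \<Rightarrow> 'p" where
  "chart_inv c = inv_into (fst c) (snd c)"

definition smooth_manifold :: "('p, 'e::euclidean_space) manifold \<Rightarrow> bool" where
  "smooth_manifold M \<longleftrightarrow>
     carrier M \<noteq> {} \<and> Hausdorff_space (mtop M) \<and> second_countable (mtop M) \<and>
     (\<Union>c\<in>atlas M. fst c) = carrier M \<and>
     (\<forall>c\<in>atlas M. openin (mtop M) (fst c) \<and> open (snd c ` fst c) \<and>
        homeomorphic_map (subtopology (mtop M) (fst c)) (top_of_set (snd c ` fst c)) (snd c)) \<and>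
     (\<forall>c\<in>atlas M. \<forall>d\<in>atlas M. smooth_on (snd c ` (fst c \<inter> fst d)) (snd d \<circ> chart_inv c))"

definition smooth_fun :: "('p, 'e::euclidean_space) manifold \<Rightarrow> ('p \<Rightarrow> real) \<Rightarrow> bool" where
  "smooth_fun M u \<longleftrightarrow> (\<forall>c\<in>atlas M. smooth_on (snd c ` fst c) (u \<circ> chart_inv c))"

definition smooth_near :: "('p, 'e::euclidean_space) manifold \<Rightarrow> 'p \<Rightarrow> ('p \<Rightarrow> real) \<Rightarrow> bool" where
  "smooth_near M p u \<longleftrightarrow>
     (\<exists>W. openin (mtop M) W \<and> p \<in> W \<and>
       (\<forall>c\<in>atlas M. smooth_on (snd c ` (fst c \<inter> W)) (u \<circ> chart_inv c)))"

text \<open>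
  Tangent vectors at \<open>p\<close> are derivations of germs of smooth functions at \<open>p\<close>, extended by \<open>0\<close> to
  functions that are not smooth near \<open>p\<close>. In a chart \<open>c\<close> at \<open>p\<close> they are exactly the directional
  derivatives \<open>coord_vec M c p v\<close>, which sends \<open>u\<close> to the derivative of \<open>u\<close> along \<open>v\<close> in the
  coordinates of \<open>c\<close>.
\<close>

type_synonym 'p tvec = "('p \<Rightarrow> real) \<Rightarrow> real"

definition coord_vec ::
  "('p, 'e::euclidean_space) manifold \<Rightarrow> ('p, 'e) chart \<Rightarrow> 'p \<Rightarrow> 'e \<Rightarrow> 'p tvec" where
  "coord_vec M c p v =
     (\<lambda>u. if smooth_near M p u then dder (u \<circ> chart_inv c) (snd c p) v else 0)"

text \<open>The differential at \<open>p\<close> of a map \<open>\<phi>\<close> into \<open>N\<close>, on tangent vectors.\<close>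

definition push ::
  "('q, 'k::euclidean_space) manifold \<Rightarrow> ('p \<Rightarrow> 'q) \<Rightarrow> 'p \<Rightarrow> 'p tvec \<Rightarrow> 'q tvec" where
  "push N \<phi> p X = (\<lambda>u. if smooth_near N (\<phi> p) u then X (u \<circ> \<phi>) else 0)"


section \<open>Semi-Riemannian manifolds\<close>

type_synonym 'p metric_field = "'p \<Rightarrow> 'p tvec \<Rightarrow> 'p tvec \<Rightarrow> real"

definition loc_metric ::
  "('p, 'e::euclidean_space) manifold \<Rightarrow> 'p metric_field \<Rightarrow> ('p, 'e) chart \<Rightarrow> 'e \<Rightarrow> 'e \<Rightarrow> 'e \<Rightarrow> real" where
  "loc_metric M g c x v w =
     g (chart_inv c x) (coord_vec M c (chart_inv c x) v) (coord_vec M c (chart_inv c x) w)"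

text \<open>A smooth symmetric nondegenerate \<open>(0,2)\<close> tensor field of constant index. Only the values of \<open>g\<close>
  on tangent vectors at points of the manifold matter.\<close>

definition semi_riemannian ::
  "('p, 'e::euclidean_space) manifold \<Rightarrow> 'p metric_field \<Rightarrow> bool" where
  "semi_riemannian M g \<longleftrightarrow>
     smooth_manifold M \<and>
     (\<forall>c\<in>atlas M.
        (\<forall>v w. smooth_on (snd c ` fst c) (\<lambda>x. loc_metric M g c x v w)) \<and>
        (\<forall>x\<in>snd c ` fst c. bilinear (loc_metric M g c x) \<and>
           (\<forall>v w. loc_metric M g c x v w = loc_metric M g c x w v) \<and>
           nondegenerate_form (loc_metric M g c x))) \<and>
     (\<exists>\<nu>. \<forall>c\<in>atlas M. \<forall>x\<in>snd c ` fst c. form_index (loc_metric M g c x) = \<nu>)"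

text \<open>
  For a chart \<open>c\<close> with \<open>p\<close> in its domain: the Ricci tensor and the Hessian at \<open>p\<close> evaluated at the
  tangent vectors \<open>coord_vec M c p v\<close> and \<open>coord_vec M c p w\<close>, the number \<open>g(\<nabla>u,\<nabla>u')\<close> at \<open>p\<close>
  and the Laplacian at \<open>p\<close>, all computed in the chart \<open>c\<close>. A tensor equation is understood to hold
  at every point in every chart of the atlas.
\<close>

definition Ric ::
  "('p, 'e::euclidean_space) manifold \<Rightarrow> 'p metric_field \<Rightarrow> ('p, 'e) chart \<Rightarrow> 'p \<Rightarrow> 'e \<Rightarrow> 'e \<Rightarrow> real" where
  "Ric M g c p v w = loc_ricci (loc_metric M g c) (snd c p) v w"

definition Hess ::
  "('p, 'e::euclidean_space) manifold \<Rightarrow> 'p metric_field \<Rightarrow> ('p \<Rightarrow> real) \<Rightarrow> ('p, 'e) chart \<Rightarrow> 'p \<Rightarrow> 'e \<Rightarrow> 'e \<Rightarrow> real" where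
  "Hess M g u c p v w = loc_hess (loc_metric M g c) (u \<circ> chart_inv c) (snd c p) v w"

definition grad_prod ::
  "('p, 'e::euclidean_space) manifold \<Rightarrow> 'p metric_field \<Rightarrow> ('p \<Rightarrow> real) \<Rightarrow> ('p \<Rightarrow> real) \<Rightarrow> ('p, 'e) chart \<Rightarrow> 'p \<Rightarrow> real" where
  "grad_prod M g u u' c p =
     loc_metric M g c (snd c p)
       (loc_grad (loc_metric M g c) (u \<circ> chart_inv c) (snd c p))
       (loc_grad (loc_metric M g c) (u' \<circ> chart_inv c) (snd c p))"

definition Laplace ::
  "('p, 'e::euclidean_space) manifold \<Rightarrow> 'p metric_field \<Rightarrow> ('p \<Rightarrow> real) \<Rightarrow> ('p, 'e) chart \<Rightarrow> 'p \<Rightarrow> real" where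
  "Laplace M g u c p = metric_trace (loc_metric M g c (snd c p)) (Hess M g u c p)"

definition drift_Laplace ::
  "('p, 'e::euclidean_space) manifold \<Rightarrow> 'p metric_field \<Rightarrow> ('p \<Rightarrow> real) \<Rightarrow> ('p \<Rightarrow> real) \<Rightarrow> ('p, 'e) chart \<Rightarrow> 'p \<Rightarrow> real" where
  "drift_Laplace M g \<omega> u c p = Laplace M g u c p - grad_prod M g u \<omega> c p"

text \<open>The tensor \<open>\<nabla>u \<otimes> \<nabla>u\<close>, that is \<open>(X,Y) \<mapsto> X(u) Y(u)\<close>.\<close>

definition grad_tensor ::
  "('p, 'e::euclidean_space) manifold \<Rightarrow> ('p \<Rightarrow> real) \<Rightarrow> ('p, 'e) chart \<Rightarrow> 'p \<Rightarrow> 'e \<Rightarrow> 'e \<Rightarrow> real" where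
  "grad_tensor M u c p v w = coord_vec M c p v u * coord_vec M c p w u"

definition metr ::
  "('p, 'e::euclidean_space) manifold \<Rightarrow> 'p metric_field \<Rightarrow> ('p, 'e) chart \<Rightarrow> 'p \<Rightarrow> 'e \<Rightarrow> 'e \<Rightarrow> real" where
  "metr M g c p v w = g p (coord_vec M c p v) (coord_vec M c p w)"

definition einstein ::
  "('p, 'e::euclidean_space) manifold \<Rightarrow> 'p metric_field \<Rightarrow> real \<Rightarrow> bool" where
  "einstein M g \<mu> \<longleftrightarrow>
     (\<forall>c\<in>atlas M. \<forall>p\<in>fst c. \<forall>v w. Ric M g c p v w = \<mu> * metr M g c p v w)"

definition einstein_harmonic ::
  "('p, 'e::euclidean_space) manifold \<Rightarrow> 'p metric_field \<Rightarrow> real \<Rightarrow> ('p \<Rightarrow> real) \<Rightarrow> real \<Rightarrow> bool" where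
  "einstein_harmonic M g \<theta> u \<mu> \<longleftrightarrow>
     (\<forall>c\<in>atlas M. \<forall>p\<in>fst c. \<forall>v w.
        Ric M g c p v w - \<theta> * grad_tensor M u c p v w = \<mu> * metr M g c p v w) \<and>
     (\<forall>c\<in>atlas M. \<forall>p\<in>fst c. Laplace M g u c p = 0)"

definition GRHS ::
  "('p, 'e::euclidean_space) manifold \<Rightarrow> 'p metric_field \<Rightarrow> ('p \<Rightarrow> real) \<Rightarrow> ('p \<Rightarrow> real) \<Rightarrow> real \<Rightarrow> real \<Rightarrow> bool" where
  "GRHS M g h u lam \<theta> \<longleftrightarrow>
     semi_riemannian M g \<and> smooth_fun M h \<and> smooth_fun M u \<and> \<theta> \<ge> 0 \<and>
     (\<forall>c\<in>atlas M. \<forall>p\<in>fst c. \<forall>v w.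
        Ric M g c p v w + Hess M g h c p v w - \<theta> * grad_tensor M u c p v w = lam * metr M g c p v w) \<and>
     (\<forall>c\<in>atlas M. \<forall>p\<in>fst c. Laplace M g u c p - grad_prod M g u h c p = 0)"


section \<open>Warped products\<close>

definition prod_manifold ::
  "('p, 'e::euclidean_space) manifold \<Rightarrow> ('q, 'k::euclidean_space) manifold
   \<Rightarrow> ('p \<times> 'q, 'e \<times> 'k) manifold" where
  "prod_manifold M N =
     \<lparr> mtop = prod_topology (mtop M) (mtop N),
       atlas = {(fst c \<times> fst d, map_prod (snd c) (snd d)) | c d. c \<in> atlas M \<and> d \<in> atlas N} \<rparr>"

definition pullback ::
  "('q, 'k::euclidean_space) manifold \<Rightarrow> ('p \<Rightarrow> 'q) \<Rightarrow> 'q metric_field \<Rightarrow> 'p metric_field" where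
  "pullback N \<phi> g p X Y = g (\<phi> p) (push N \<phi> p X) (push N \<phi> p Y)"

definition warped_metric ::
  "('p, 'e::euclidean_space) manifold \<Rightarrow> 'p metric_field \<Rightarrow> ('q, 'k::euclidean_space) manifold
   \<Rightarrow> 'q metric_field \<Rightarrow> ('p \<Rightarrow> real) \<Rightarrow> ('p \<times> 'q) metric_field" where
  "warped_metric B g\<^sub>B F g\<^sub>F f z X Y =
     pullback B fst g\<^sub>B z X Y + ((f \<circ> fst) z)^2 * pullback F snd g\<^sub>F z X Y"

end

theory Submission
  imports Defs
begin

text \<open>
  Write \<open>m\<close> for the dimension of \<open>F\<close>. In a product chart the warped metric is
  \<open>G = GB + f\<^sup>2 GF\<close>, and the Koszul formula gives its connection in terms of the connections of the
  factors (\<open>christoffel_warped\<close>):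

  \<open>\<Gamma>((v1,v2),(w1,w2)) = (\<Gamma>\<^sub>B(v1,w1) - f GF(v2,w2) \<nabla>f, \<Gamma>\<^sub>F(v2,w2) + (df(v1)/f) w2 + (df(w1)/f) v2)\<close>.

  Differentiating this once more and taking the trace yields the Ricci tensor (\<open>ricci_warped\<close>)

  \<open>Ric = Ric\<^sub>B - (m/f) Hess f + Ric\<^sub>F - (f \<Delta>f + (m-1) |\<nabla>f|\<^sup>2) GF\<close>,

  and a function \<open>h\<close> lifted from \<open>B\<close> has Hessian \<open>Hess\<^sub>B h + f \<langle>\<nabla>f,\<nabla>h\<rangle> GF\<close>. None of these tensors
  has mixed components, and neither has \<open>\<nabla>u \<otimes> \<nabla>u\<close> when \<open>u\<close> is lifted from one of the factors. So the
  tensor equation of the soliton says that a tensor \<open>E\<close> on \<open>B\<close>, a tensor \<open>R\<close> on \<open>F\<close> (\<open>Ric\<^sub>F\<close>,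
  diminished by \<open>\<theta> \<nabla>u \<otimes> \<nabla>u\<close> if \<open>u\<close> comes from \<open>F\<close>) and the function
  \<open>K = f \<Delta>f + (m-1) |\<nabla>f|\<^sup>2 + \<lambda> f\<^sup>2 - f \<langle>\<nabla>f,\<nabla>h\<rangle>\<close> on \<open>B\<close> satisfy \<open>E + R = K GF\<close>. Separation of variables
  (\<open>separate_tensor_equation\<close>) turns this into \<open>E = 0\<close>, \<open>R = \<mu> GF\<close> and \<open>K = \<mu>\<close> for a constant \<open>\<mu>\<close>,
  because \<open>GF\<close> is not zero. The scalar equation follows from \<open>\<Delta>u = \<Delta>\<^sub>B u + (m/f) \<langle>\<nabla>f,\<nabla>u\<rangle>\<close> for \<open>u\<close>
  lifted from \<open>B\<close>, and from \<open>\<Delta>u = f\<^sup>-\<^sup>2 \<Delta>\<^sub>F u\<close> and \<open>\<langle>\<nabla>u,\<nabla>h\<rangle> = 0\<close> for \<open>u\<close> lifted from \<open>F\<close>.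

  A soliton is in particular a semi-Riemannian manifold. The product is shown to be one in
  \<open>smooth_manifold_prod\<close> and \<open>semi_riemannian_warped\<close>; its index is the sum of the indices of the
  factors (\<open>form_index_sum\<close>). Christoffel symbols and gradients are defined through the inverse of the
  metric, and their differentiability comes from the inverse function theorem
  (\<open>sharp_differentiable\<close>).
\<close>

section \<open>Smooth functions on open sets\<close>

lemma dder_eqI: "(F has_derivative F') (at x) \<Longrightarrow> dder F x v = F' v"
  unfolding dder_def by (metis frechet_derivative_at)

lemma has_derivative_dder: "F differentiable (at x) \<Longrightarrow> (F has_derivative dder F x) (at x)"
  unfolding dder_def by (simp add: frechet_derivative_works)

lemma linear_dder: "F differentiable (at x) \<Longrightarrow> linear (dder F x)"
  using has_derivative_dder has_derivative_linear by blast

lemma dder_zero: "F differentiable (at x) \<Longrightarrow> dder F x 0 = 0"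
  using linear_0[OF linear_dder] .

lemma differentiable_cong_open:
  assumes "F differentiable (at x)" "open S" "x \<in> S" "\<And>y. y \<in> S \<Longrightarrow> F y = H y"
  shows "H differentiable (at x)"
  by (meson assms differentiable_def has_derivative_transform_within_open)

text \<open>No differentiability is needed: where neither function has a derivative, both sides are the same
  arbitrary value.\<close>

lemma dder_cong_open:
  assumes "open S" "x \<in> S" "\<And>y. y \<in> S \<Longrightarrow> F y = H y"
  shows "dder F x v = dder H x v"
proof (cases "F differentiable (at x)")
  case True
  then show ?thesis
    unfolding dder_def using assms by (metis frechet_derivative_transform_within_open)
next
  case False
  then have "\<not> H differentiable (at x)"
    using differentiable_cong_open[of H x S F] assms by auto
  with False have "(\<lambda>F'. (F has_derivative F') (at x)) = (\<lambda>F'. (H has_derivative F') (at x))"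
    by (auto simp: differentiable_def)
  then show ?thesis
    unfolding dder_def frechet_derivative_def by simp
qed

lemma Ck_on_Suc_dder:
  "Ck_on (Suc k) S F \<longleftrightarrow>
     (\<forall>x\<in>S. F differentiable (at x)) \<and> (\<forall>v. Ck_on k S (\<lambda>x. dder F x v))"
  by (simp add: dder_def)

\<comment> \<open>Derivatives are handled in the form given by the preceding lemma.\<close>
declare Ck_on.simps(2) [simp del]

lemma Ck_on_cong:
  assumes "open S" "\<And>x. x \<in> S \<Longrightarrow> F x = H x"
  shows "Ck_on k S F \<longleftrightarrow> Ck_on k S H"
  using assms(2)
proof (induction k arbitrary: F H)
  case 0
  then show ?case by (auto intro: continuous_on_cong)
next
  case (Suc k)
  have "(\<forall>x\<in>S. F differentiable (at x)) \<longleftrightarrow> (\<forall>x\<in>S. H differentiable (at x))"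
    using differentiable_cong_open[OF _ assms(1)] Suc.prems by (metis (no_types, lifting))
  moreover have "Ck_on k S (\<lambda>x. dder F x v) = Ck_on k S (\<lambda>x. dder H x v)" for v
    using Suc.prems by (intro Suc.IH dder_cong_open[OF assms(1)]) auto
  ultimately show ?case by (simp add: Ck_on_Suc_dder)
qed

lemma smooth_on_cong:
  assumes "open S" "\<And>x. x \<in> S \<Longrightarrow> F x = H x"
  shows "smooth_on S F \<longleftrightarrow> smooth_on S H"
  using Ck_on_cong[OF assms] by (simp add: smooth_on_def)

lemma Ck_on_lower: "Ck_on (Suc k) S F \<Longrightarrow> Ck_on k S F"
proof (induction k arbitrary: F)
  case 0
  then show ?case
    by (auto simp: Ck_on_Suc_dder intro!: continuous_at_imp_continuous_on differentiable_imp_continuous_within)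
next
  case (Suc k)
  then show ?case by (metis Ck_on_Suc_dder)
qed

lemma smooth_on_differentiable: "smooth_on S F \<Longrightarrow> x \<in> S \<Longrightarrow> F differentiable (at x)"
  unfolding smooth_on_def by (metis Ck_on_Suc_dder)

lemma smooth_on_dder: "smooth_on S F \<Longrightarrow> smooth_on S (\<lambda>x. dder F x v)"
  unfolding smooth_on_def by (metis Ck_on_Suc_dder)

lemma Ck_on_add:
  assumes "open S"
  shows "Ck_on k S F \<Longrightarrow> Ck_on k S H \<Longrightarrow> Ck_on k S (\<lambda>x. F x + H x)"
proof (induction k arbitrary: F H)
  case 0
  then show ?case by (auto intro: continuous_on_add)
next
  case (Suc k)
  have d: "((\<lambda>x. F x + H x) has_derivative (\<lambda>v. dder F x v + dder H x v)) (at x)" if "x \<in> S" for x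
    using Suc.prems that by (intro has_derivative_add has_derivative_dder) (auto simp: Ck_on_Suc_dder)
  have "Ck_on k S (\<lambda>x. dder (\<lambda>x. F x + H x) x v)" for v
    using Suc by (subst Ck_on_cong[OF assms dder_eqI[OF d]]) (auto simp: Ck_on_Suc_dder)
  then show ?case using d by (auto simp: Ck_on_Suc_dder differentiable_def)
qed

lemma Ck_on_mult:
  fixes F H :: "'e::euclidean_space \<Rightarrow> real"
  assumes "open S"
  shows "Ck_on k S F \<Longrightarrow> Ck_on k S H \<Longrightarrow> Ck_on k S (\<lambda>x. F x * H x)"
proof (induction k arbitrary: F H)
  case 0
  then show ?case by (auto intro: continuous_on_mult)
next
  case (Suc k)
  have d: "((\<lambda>x. F x * H x) has_derivative (\<lambda>v. F x * dder H x v + dder F x v * H x)) (at x)"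
    if "x \<in> S" for x
    using Suc.prems that by (intro has_derivative_mult has_derivative_dder) (auto simp: Ck_on_Suc_dder)
  have "Ck_on k S (\<lambda>x. dder (\<lambda>x. F x * H x) x v)" for v
    using Suc.prems Ck_on_lower[OF Suc.prems(1)] Ck_on_lower[OF Suc.prems(2)]
    by (subst Ck_on_cong[OF assms dder_eqI[OF d]])
       (auto simp: Ck_on_Suc_dder intro!: Ck_on_add[OF assms] Suc.IH)
  then show ?case using d by (auto simp: Ck_on_Suc_dder differentiable_def)
qed

lemma Ck_on_Pair:
  assumes "open S"
  shows "Ck_on k S F \<Longrightarrow> Ck_on k S H \<Longrightarrow> Ck_on k S (\<lambda>x. (F x, H x))"
proof (induction k arbitrary: F H)
  case 0
  then show ?case by (auto intro: continuous_on_Pair)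
next
  case (Suc k)
  have d: "((\<lambda>x. (F x, H x)) has_derivative (\<lambda>v. (dder F x v, dder H x v))) (at x)"
    if "x \<in> S" for x
    using Suc.prems that by (intro has_derivative_Pair has_derivative_dder) (auto simp: Ck_on_Suc_dder)
  have "Ck_on k S (\<lambda>x. dder (\<lambda>x. (F x, H x)) x v)" for v
    using Suc by (subst Ck_on_cong[OF assms dder_eqI[OF d]]) (auto simp: Ck_on_Suc_dder)
  then show ?case using d by (auto simp: Ck_on_Suc_dder differentiable_def)
qed

lemma dder_compose_linear:
  assumes "linear L" "F differentiable (at (L x))"
  shows "(\<lambda>y. F (L y)) differentiable (at x)" "dder (\<lambda>y. F (L y)) x v = dder F (L x) (L v)"
proof -
  have "((\<lambda>y. F (L y)) has_derivative (\<lambda>v. dder F (L x) (L v))) (at x)"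
    using has_derivative_compose[OF linear_imp_has_derivative[OF assms(1)]]
      has_derivative_dder[OF assms(2)] by blast
  then show "(\<lambda>y. F (L y)) differentiable (at x)" "dder (\<lambda>y. F (L y)) x v = dder F (L x) (L v)"
    by (auto simp: differentiable_def dder_eqI)
qed

lemma Ck_on_compose_linear:
  fixes L :: "'a::euclidean_space \<Rightarrow> 'b::euclidean_space"
  assumes "open S'" "linear L" "L ` S' \<subseteq> S"
  shows "Ck_on k S F \<Longrightarrow> Ck_on k S' (\<lambda>x. F (L x))"
proof (induction k arbitrary: F)
  case 0
  then show ?case
    using assms continuous_on_compose2[of S F S' L] linear_continuous_on[of L S']
    by (simp add: linear_conv_bounded_linear)
next
  case (Suc k)
  have *: "F differentiable at (L x)" if "x \<in> S'" for x
    using Suc.prems assms that by (auto simp: Ck_on_Suc_dder)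
  have "Ck_on k S' (\<lambda>x. dder (\<lambda>x. F (L x)) x v)" for v
    using Suc
    by (subst Ck_on_cong[OF assms(1) dder_compose_linear(2)[OF assms(2) *]]) (auto simp: Ck_on_Suc_dder)
  then show ?case using dder_compose_linear(1)[OF assms(2) *] by (auto simp: Ck_on_Suc_dder)
qed

lemma smooth_on_add: "open S \<Longrightarrow> smooth_on S F \<Longrightarrow> smooth_on S H \<Longrightarrow> smooth_on S (\<lambda>x. F x + H x)"
  and smooth_on_Pair: "open S \<Longrightarrow> smooth_on S F \<Longrightarrow> smooth_on S J \<Longrightarrow> smooth_on S (\<lambda>x. (F x, J x))"
  and smooth_on_compose_linear:
    "open S' \<Longrightarrow> linear L \<Longrightarrow> L ` S' \<subseteq> S \<Longrightarrow> smooth_on S F \<Longrightarrow> smooth_on S' (\<lambda>x. F (L x))"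
  by (auto simp: smooth_on_def Ck_on_add Ck_on_Pair Ck_on_compose_linear)

lemma smooth_on_mult:
  fixes F H :: "'e::euclidean_space \<Rightarrow> real"
  shows "open S \<Longrightarrow> smooth_on S F \<Longrightarrow> smooth_on S H \<Longrightarrow> smooth_on S (\<lambda>x. F x * H x)"
  by (auto simp: smooth_on_def Ck_on_mult)

section \<open>Nondegenerate bilinear forms\<close>

lemma bilinear_sum_Basis:
  fixes b :: "'e::euclidean_space \<Rightarrow> 'e \<Rightarrow> real"
  assumes "bilinear b"
  shows "b z w = (\<Sum>e\<in>Basis. (z \<bullet> e) * b e w)"
proof -
  have l: "linear (\<lambda>z. b z w)" using assms by (simp add: bilinear_def)
  have "b z w = b (\<Sum>e\<in>Basis. (z \<bullet> e) *\<^sub>R e) w" by (simp add: euclidean_representation)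
  also have "\<dots> = (\<Sum>e\<in>Basis. (z \<bullet> e) * b e w)"
    using linear_sum[OF l, of "\<lambda>e. (z \<bullet> e) *\<^sub>R e" Basis] linear_scale[OF l] by simp
  finally show ?thesis .
qed

lemma functional_eq_inner:
  fixes L :: "'e::euclidean_space \<Rightarrow> real"
  assumes "linear L"
  shows "L w = (\<Sum>e\<in>Basis. L e *\<^sub>R e) \<bullet> w"
proof -
  have "L w = L (\<Sum>e\<in>Basis. (w \<bullet> e) *\<^sub>R e)" by (simp add: euclidean_representation)
  also have "\<dots> = (\<Sum>e\<in>Basis. (w \<bullet> e) * L e)"
    using linear_sum[OF assms, of "\<lambda>e. (w \<bullet> e) *\<^sub>R e" Basis] linear_scale[OF assms] by simp
  finally show ?thesis by (simp add: inner_sum_left inner_commute[of w] mult.commute)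
qed

text \<open>The matrix of a bilinear form: the endomorphism that represents the form with respect to
  the Euclidean inner product.\<close>

definition form_op :: "('e::euclidean_space \<Rightarrow> 'e \<Rightarrow> real) \<Rightarrow> 'e \<Rightarrow> 'e" where
  "form_op b z = (\<Sum>e\<in>Basis. b z e *\<^sub>R e)"

lemma form_op_inner:
  assumes "bilinear b"
  shows "form_op b z \<bullet> w = b z w"
  using functional_eq_inner[of "b z" w] assms by (simp add: form_op_def bilinear_def)

lemma linear_form_op: "bilinear b \<Longrightarrow> linear (form_op b)"
  by (rule linearI)
     (simp_all add: form_op_def bilinear_ladd bilinear_lmul scaleR_add_left sum.distrib scaleR_sum_right)

lemma inj_form_op:
  assumes "bilinear b" "nondegenerate_form b"
  shows "inj (form_op b)"
proof -
  have "z = 0" if "form_op b z = 0" for z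
    using assms that form_op_inner[OF assms(1), of z] by (auto simp: nondegenerate_form_def)
  then show ?thesis using linear_injective_0[OF linear_form_op[OF assms(1)]] by blast
qed

lemma nondegenerate_unique:
  assumes "bilinear b" "nondegenerate_form b" "\<And>w. b z w = b z' w"
  shows "z = z'"
proof -
  have "b (z - z') w = 0" for w using assms by (simp add: bilinear_lsub)
  then show ?thesis using assms(2) unfolding nondegenerate_form_def
    by (metis eq_iff_diff_eq_0)
qed

lemma sharp_eqI:
  assumes "bilinear b" "nondegenerate_form b" "\<And>w. b z w = L w"
  shows "sharp b L = z"
  unfolding sharp_def using nondegenerate_unique[OF assms(1,2)] assms(3)
  by (intro the_equality) auto

lemma sharp_works:
  assumes "bilinear b" "nondegenerate_form b" "linear L"
  shows "b (sharp b L) w = L w"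
proof -
  obtain z where z: "form_op b z = (\<Sum>e\<in>Basis. L e *\<^sub>R e)"
    using linear_injective_imp_surjective[OF linear_form_op inj_form_op] assms
    by (metis surjD)
  have "b z w = L w" for w
    using form_op_inner[OF assms(1), of z w] z functional_eq_inner[OF assms(3), of w] by simp
  then show ?thesis using sharp_eqI[OF assms(1,2)] by metis
qed

lemma form_op_sharp:
  assumes "bilinear b" "nondegenerate_form b" "linear L"
  shows "form_op b (sharp b L) = (\<Sum>e\<in>Basis. L e *\<^sub>R e)"
  using sharp_works[OF assms] by (simp add: form_op_def)

text \<open>The map \<open>(y, z) \<mapsto> (y, A\<^sub>y z)\<close>, where \<open>A\<^sub>y\<close> is the matrix of \<open>G y\<close>, has invertible derivative.
  The inverse function theorem then gives the differentiability of \<open>A\<^sub>y\<^sup>-\<^sup>1\<close> applied to a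
  differentiable right-hand side.\<close>

lemma sharp_differentiable:
  fixes G :: "'e::euclidean_space \<Rightarrow> 'e \<Rightarrow> 'e \<Rightarrow> real"
  assumes S: "open S" "x \<in> S"
    and bil: "\<And>y. y \<in> S \<Longrightarrow> bilinear (G y)" and nd: "\<And>y. y \<in> S \<Longrightarrow> nondegenerate_form (G y)"
    and dG: "\<And>y v w. y \<in> S \<Longrightarrow> (\<lambda>y. G y v w) differentiable (at y)"
    and L: "\<And>y. y \<in> S \<Longrightarrow> linear (L y)" and dL: "\<And>w. (\<lambda>y. L y w) differentiable (at x)"
  shows "(\<lambda>y. sharp (G y) (L y)) differentiable (at x)"
proof -
  define \<Phi> where "\<Phi> = (\<lambda>p::'e\<times>'e. (fst p, \<Sum>e\<in>Basis. (\<Sum>d\<in>Basis. (snd p \<bullet> d) * G (fst p) d e) *\<^sub>R e))"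
  have \<Phi>_eq: "\<Phi> (y, z) = (y, form_op (G y) z)" if "y \<in> S" for y z
    using bilinear_sum_Basis[OF bil[OF that], of z, symmetric] by (simp add: \<Phi>_def form_op_def)
  have inv_ex: "\<exists>B. (\<forall>z. B (form_op (G y) z) = z) \<and> (\<forall>z. form_op (G y) (B z) = z)"
    if "y \<in> S" for y
  proof -
    have l: "linear (form_op (G y))" and i: "inj (form_op (G y))"
      using linear_form_op inj_form_op bil nd that by auto
    from linear_injective_isomorphism[OF l i] show ?thesis by blast
  qed
  then obtain A where A: "\<And>y z. y \<in> S \<Longrightarrow> A y (form_op (G y) z) = z"
      "\<And>y z. y \<in> S \<Longrightarrow> form_op (G y) (A y z) = z"
    by metis
  define \<Psi> where "\<Psi> = (\<lambda>p::'e\<times>'e. (fst p, A (fst p) (snd p)))"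
  \<comment> \<open>The derivative of \<open>\<Phi>\<close>, and below its right inverse \<open>D'\<close> at \<open>(x, z0)\<close>.\<close>
  define D where "D = (\<lambda>(y, z) (h, k::'e). (h, form_op (G y) k
      + (\<Sum>e\<in>Basis. (\<Sum>d\<in>Basis. (z \<bullet> d) * dder (\<lambda>y. G y d e) y h) *\<^sub>R e)))"
  have der: "(\<Phi> has_derivative D (y, z)) (at (y, z))" if "y \<in> S" for y z
  proof -
    have g: "((\<lambda>p. G (fst p) d e) has_derivative (\<lambda>h. dder (\<lambda>y. G y d e) y (fst h))) (at (y, z))" for d e
      using has_derivative_compose[OF has_derivative_fst[OF has_derivative_ident], of "\<lambda>y. G y d e" _ "(y,z)"]
        has_derivative_dder[OF dG[OF that]] by simp
    have "(\<Phi> has_derivative (\<lambda>h. (fst h, \<Sum>e\<in>Basis.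
        (\<Sum>d\<in>Basis. (z \<bullet> d) * dder (\<lambda>y. G y d e) y (fst h) + (snd h \<bullet> d) * G y d e) *\<^sub>R e))) (at (y, z))"
      unfolding \<Phi>_def by (auto intro!: derivative_eq_intros g)
    moreover have "(\<lambda>h. (fst h, \<Sum>e\<in>Basis.
        (\<Sum>d\<in>Basis. (z \<bullet> d) * dder (\<lambda>y. G y d e) y (fst h) + (snd h \<bullet> d) * G y d e) *\<^sub>R e)) = D (y, z)"
      using bilinear_sum_Basis[OF bil[OF that], symmetric]
      by (auto simp: D_def fun_eq_iff form_op_def sum.distrib scaleR_add_left)
    ultimately show ?thesis by simp
  qed
  define z0 where "z0 = sharp (G x) (L x)"
  define E where "E = (\<lambda>h::'e. (\<Sum>e\<in>Basis. (\<Sum>d\<in>Basis. (z0 \<bullet> d) * dder (\<lambda>y. G y d e) x h) *\<^sub>R e))"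
  define D' where "D' = (\<lambda>(h, l). (h, A x (l - E h)))"
  have "(\<Psi> has_derivative D') (at (\<Phi> (x, z0)))"
  proof (rule has_derivative_inverse_strong[where f = \<Phi> and x = "(x, z0)" and S = "S \<times> UNIV"])
    show "open (S \<times> (UNIV::'e set))" using S by (auto intro: open_Times)
    show "(x, z0) \<in> S \<times> UNIV" using S by auto
    show "continuous_on (S \<times> UNIV) \<Phi>"
      using der by (auto intro!: continuous_at_imp_continuous_on has_derivative_continuous)
    show "\<Psi> (\<Phi> p) = p" if "p \<in> S \<times> UNIV" for p
      using that A(1) \<Phi>_eq by (cases p) (auto simp: \<Psi>_def)
    show "(\<Phi> has_derivative D (x, z0)) (at (x, z0))" using der S by auto
    show "D (x, z0) \<circ> D' = id"
      using A(2)[OF S(2)] by (auto simp: D_def D'_def E_def fun_eq_iff)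
  qed
  then have \<Psi>': "\<Psi> differentiable (at (\<Phi> (x, z0)))" by (auto simp: differentiable_def)
  \<comment> \<open>\<open>sharp (G y) (L y)\<close> is the second component of \<open>\<Psi> (\<eta> y)\<close>.\<close>
  define \<eta> where "\<eta> = (\<lambda>y. (y, \<Sum>e\<in>Basis. L y e *\<^sub>R e))"
  have "\<Phi> (x, z0) = \<eta> x"
    using \<Phi>_eq[OF S(2)] form_op_sharp[OF bil nd L] S(2) by (simp add: \<eta>_def z0_def)
  moreover have "\<eta> differentiable (at x)"
  proof -
    have "(\<eta> has_derivative (\<lambda>h. (h, \<Sum>e\<in>Basis. dder (\<lambda>y. L y e) x h *\<^sub>R e))) (at x)"
      unfolding \<eta>_def by (auto intro!: derivative_eq_intros has_derivative_dder dL)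
    then show ?thesis by (auto simp: differentiable_def)
  qed
  ultimately have "(\<Psi> \<circ> \<eta>) differentiable (at x)"
    using \<Psi>' by (metis differentiable_chain_at)
  then have "(\<lambda>y. snd (\<Psi> (\<eta> y))) differentiable (at x)"
    unfolding differentiable_def comp_def using has_derivative_snd by blast
  moreover have "snd (\<Psi> (\<eta> y)) = sharp (G y) (L y)" if "y \<in> S" for y
    using form_op_sharp[OF bil nd L] that A(1)[OF that, of "sharp (G y) (L y)"]
    by (simp add: \<Psi>_def \<eta>_def)
  ultimately show ?thesis
    using differentiable_cong_open[OF _ S] by (metis (no_types, lifting))
qed

section \<open>The Levi-Civita connection in a coordinate domain\<close>

text \<open>A semi-Riemannian metric in coordinates on an open set, without the condition on the index.\<close>

locale local_metric =
  fixes S :: "'e::euclidean_space set" and G :: "'e \<Rightarrow> 'e \<Rightarrow> 'e \<Rightarrow> real"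
  assumes open_dom: "open S"
    and bil: "x \<in> S \<Longrightarrow> bilinear (G x)"
    and sym: "x \<in> S \<Longrightarrow> G x v w = G x w v"
    and nondeg: "x \<in> S \<Longrightarrow> nondegenerate_form (G x)"
    and smooth: "smooth_on S (\<lambda>x. G x v w)"
begin

lemma bil_simps:
  assumes "x \<in> S"
  shows "G x (u + v) w = G x u w + G x v w" "G x u (v + w) = G x u v + G x u w"
    "G x (c *\<^sub>R v) w = c * G x v w" "G x v (c *\<^sub>R w) = c * G x v w"
    "G x (u - v) w = G x u w - G x v w" "G x u (v - w) = G x u v - G x u w"
  using bil[OF assms]
  by (simp_all add: bilinear_ladd bilinear_radd bilinear_lmul bilinear_rmul bilinear_lsub bilinear_rsub)

lemma metric_unique: "x \<in> S \<Longrightarrow> (\<And>w. G x z w = G x z' w) \<Longrightarrow> z = z'"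
  using nondegenerate_unique bil nondeg by blast

lemma metric_differentiable: "x \<in> S \<Longrightarrow> (\<lambda>y. G y v w) differentiable (at x)"
  using smooth smooth_on_differentiable by blast

lemma dder_metric_differentiable:
  "x \<in> S \<Longrightarrow> (\<lambda>y. dder (\<lambda>y. G y v w) y z) differentiable (at x)"
  using smooth smooth_on_differentiable smooth_on_dder by blast

lemma has_derivative_metric:
  "x \<in> S \<Longrightarrow> ((\<lambda>y. G y v w) has_derivative dder (\<lambda>y. G y v w) x) (at x)"
  by (simp add: has_derivative_dder metric_differentiable)

lemma dder_metric_linear:
  assumes "x \<in> S"
  shows "dder (\<lambda>y. G y (u + v) w) x z = dder (\<lambda>y. G y u w) x z + dder (\<lambda>y. G y v w) x z"
    and "dder (\<lambda>y. G y (c *\<^sub>R v) w) x z = c * dder (\<lambda>y. G y v w) x z"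
    and "dder (\<lambda>y. G y v w) x z = dder (\<lambda>y. G y w v) x z"
proof -
  have "dder (\<lambda>y. G y (u + v) w) x z = dder (\<lambda>y. G y u w + G y v w) x z"
    by (rule dder_cong_open[OF open_dom assms]) (simp add: bil_simps)
  also have "\<dots> = dder (\<lambda>y. G y u w) x z + dder (\<lambda>y. G y v w) x z"
    by (rule dder_eqI) (intro has_derivative_add has_derivative_metric assms)
  finally show "dder (\<lambda>y. G y (u + v) w) x z = dder (\<lambda>y. G y u w) x z + dder (\<lambda>y. G y v w) x z" .
  have "dder (\<lambda>y. G y (c *\<^sub>R v) w) x z = dder (\<lambda>y. c * G y v w) x z"
    by (rule dder_cong_open[OF open_dom assms]) (simp add: bil_simps)
  also have "\<dots> = c * dder (\<lambda>y. G y v w) x z"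
    by (rule dder_eqI) (intro has_derivative_mult_right has_derivative_metric assms)
  finally show "dder (\<lambda>y. G y (c *\<^sub>R v) w) x z = c * dder (\<lambda>y. G y v w) x z" .
  show "dder (\<lambda>y. G y v w) x z = dder (\<lambda>y. G y w v) x z"
    by (rule dder_cong_open[OF open_dom assms]) (rule sym)
qed

text \<open>The right-hand side of the Koszul formula for coordinate vector fields.\<close>

definition koszul :: "'e \<Rightarrow> 'e \<Rightarrow> 'e \<Rightarrow> 'e \<Rightarrow> real" where
  "koszul x v w z =
     (dder (\<lambda>y. G y w z) x v + dder (\<lambda>y. G y v z) x w - dder (\<lambda>y. G y v w) x z) / 2"

lemma dder_metric_dir:
  assumes "x \<in> S"
  shows "dder (\<lambda>y. G y v w) x (z + z') = dder (\<lambda>y. G y v w) x z + dder (\<lambda>y. G y v w) x z'"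
    and "dder (\<lambda>y. G y v w) x (c *\<^sub>R z) = c * dder (\<lambda>y. G y v w) x z"
  using linear_add[OF linear_dder[OF metric_differentiable[OF assms]]]
    linear_scale[OF linear_dder[OF metric_differentiable[OF assms]]] by auto

lemma dder_metric_linear_right:
  assumes "x \<in> S"
  shows "dder (\<lambda>y. G y w (u + v)) x z = dder (\<lambda>y. G y w u) x z + dder (\<lambda>y. G y w v) x z"
    and "dder (\<lambda>y. G y w (c *\<^sub>R v)) x z = c * dder (\<lambda>y. G y w v) x z"
  using dder_metric_linear(1,2)[OF assms] dder_metric_linear(3)[OF assms, of w] by simp_all

lemmas dder_metric_simps = dder_metric_linear(1,2) dder_metric_linear_right dder_metric_dir

lemma linear_koszul: "x \<in> S \<Longrightarrow> linear (koszul x v w)"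
  by (rule linearI) (simp_all add: koszul_def dder_metric_simps algebra_simps add_divide_distrib diff_divide_distrib)

lemma christoffel_koszul: "x \<in> S \<Longrightarrow> G x (christoffel G x v w) z = koszul x v w z"
  using sharp_works[OF bil nondeg linear_koszul]
  by (simp add: christoffel_def koszul_def[abs_def])

lemma koszul_sym: "x \<in> S \<Longrightarrow> koszul x v w z = koszul x w v z"
  using dder_metric_linear(3)[of x v w] by (simp add: koszul_def)

lemma christoffel_sym: 
  assumes "x \<in> S"
  shows "christoffel G x v w = christoffel G x w v"
  using koszul_sym[OF assms] by (auto intro!: metric_unique[OF assms] simp: christoffel_koszul[OF assms])

lemma christoffel_add_left:
  assumes "x \<in> S"
  shows "christoffel G x (u + v) w = christoffel G x u w + christoffel G x v w"
  by (rule metric_unique[OF assms])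
     (simp add: bil_simps[OF assms] christoffel_koszul[OF assms] koszul_def
       dder_metric_simps[OF assms] field_simps)

lemma christoffel_scale_left:
  assumes "x \<in> S"
  shows "christoffel G x (c *\<^sub>R v) w = c *\<^sub>R christoffel G x v w"
  by (rule metric_unique[OF assms])
     (simp add: bil_simps[OF assms] christoffel_koszul[OF assms] koszul_def
       dder_metric_simps[OF assms] field_simps)

lemma christoffel_add_right:
    "x \<in> S \<Longrightarrow> christoffel G x w (u + v) = christoffel G x w u + christoffel G x w v"
  and christoffel_scale_right:
    "x \<in> S \<Longrightarrow> christoffel G x w (c *\<^sub>R v) = c *\<^sub>R christoffel G x w v"
  using christoffel_add_left christoffel_scale_left christoffel_sym by metis+

lemma christoffel_diff_right:
  "x \<in> S \<Longrightarrow> christoffel G x w (u - v) = christoffel G x w u - christoffel G x w v"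
  by (metis christoffel_add_right add_diff_cancel diff_add_cancel)

lemmas christoffel_simps = christoffel_add_left christoffel_scale_left
  christoffel_add_right christoffel_scale_right christoffel_diff_right

lemma christoffel_differentiable:
  assumes "x \<in> S"
  shows "(\<lambda>y. christoffel G y v w) differentiable (at x)"
proof -
  have "(\<lambda>y. sharp (G y) (koszul y v w)) differentiable (at x)"
    by (rule sharp_differentiable[OF open_dom assms bil nondeg metric_differentiable linear_koszul])
       (auto simp: koszul_def intro!: derivative_intros dder_metric_differentiable assms)
  then show ?thesis by (simp add: christoffel_def koszul_def[abs_def])
qed

lemma christoffel_compatible:
  assumes "x \<in> S"
  shows "dder (\<lambda>y. G y v w) x z = G x (christoffel G x z v) w + G x v (christoffel G x z w)"
proof -
  have "koszul x z v w + koszul x z w v = dder (\<lambda>y. G y v w) x z"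
    using dder_metric_linear(3)[OF assms, of v w] dder_metric_linear(3)[OF assms, of z w]
      dder_metric_linear(3)[OF assms, of z v]
    by (simp add: koszul_def field_simps)
  then show ?thesis
    by (simp add: sym[OF assms, of v] christoffel_koszul[OF assms])
qed

text \<open>The product rule for the pairing of a differentiable vector field with a constant one.\<close>

lemma dder_metric_field:
  assumes "x \<in> S" "Z differentiable (at x)"
  shows "(\<lambda>y. G y (Z y) w) differentiable (at x)"
    and "dder (\<lambda>y. G y (Z y) w) x v = G x (dder Z x v) w + dder (\<lambda>y. G y (Z x) w) x v"
proof -
  have lin: "linear (\<lambda>z. dder (\<lambda>y. G y z w) x v)" for v
    by (rule linearI) (simp_all add: dder_metric_simps assms)
  have expand: "dder (\<lambda>y. G y z w) x v = (\<Sum>e\<in>Basis. (z \<bullet> e) * dder (\<lambda>y. G y e w) x v)" for z v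
  proof -
    have "dder (\<lambda>y. G y z w) x v = dder (\<lambda>y. G y (\<Sum>e\<in>Basis. (z \<bullet> e) *\<^sub>R e) w) x v"
      by (simp add: euclidean_representation)
    also have "\<dots> = (\<Sum>e\<in>Basis. (z \<bullet> e) * dder (\<lambda>y. G y e w) x v)"
      using linear_sum[OF lin, of "\<lambda>e. (z \<bullet> e) *\<^sub>R e" Basis] by (simp add: dder_metric_simps assms)
    finally show ?thesis .
  qed
  have "((\<lambda>y. \<Sum>e\<in>Basis. (Z y \<bullet> e) * G y e w) has_derivative
      (\<lambda>v. \<Sum>e\<in>Basis. (Z x \<bullet> e) * dder (\<lambda>y. G y e w) x v + (dder Z x v \<bullet> e) * G x e w)) (at x)"
    by (auto intro!: derivative_eq_intros has_derivative_dder assms has_derivative_metric)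
  moreover have "(\<lambda>v. \<Sum>e\<in>Basis. (Z x \<bullet> e) * dder (\<lambda>y. G y e w) x v + (dder Z x v \<bullet> e) * G x e w)
      = (\<lambda>v. G x (dder Z x v) w + dder (\<lambda>y. G y (Z x) w) x v)"
    using expand[of "Z x", symmetric] bilinear_sum_Basis[OF bil[OF assms(1)], symmetric]
    by (simp add: sum.distrib fun_eq_iff)
  ultimately have "((\<lambda>y. \<Sum>e\<in>Basis. (Z y \<bullet> e) * G y e w) has_derivative
      (\<lambda>v. G x (dder Z x v) w + dder (\<lambda>y. G y (Z x) w) x v)) (at x)" by simp
  then have "((\<lambda>y. G y (Z y) w) has_derivative
      (\<lambda>v. G x (dder Z x v) w + dder (\<lambda>y. G y (Z x) w) x v)) (at x)"
    using bilinear_sum_Basis[OF bil, symmetric]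
    by (rule has_derivative_transform_within_open[OF _ open_dom assms(1)]) auto
  then show "(\<lambda>y. G y (Z y) w) differentiable (at x)"
    "dder (\<lambda>y. G y (Z y) w) x v = G x (dder Z x v) w + dder (\<lambda>y. G y (Z x) w) x v"
    by (auto simp: differentiable_def dder_eqI)
qed

lemma loc_grad_works:
  assumes "x \<in> S" "U differentiable (at x)"
  shows "G x (loc_grad G U x) w = dder U x w"
  unfolding loc_grad_def using sharp_works[OF bil nondeg linear_dder] assms by blast

lemma loc_grad_differentiable:
  assumes "x \<in> S" "smooth_on S U"
  shows "loc_grad G U differentiable (at x)"
  unfolding loc_grad_def
  by (rule sharp_differentiable[OF open_dom assms(1) bil nondeg metric_differentiable linear_dder])
     (use smooth_on_differentiable[OF assms(2)]
        smooth_on_differentiable[OF smooth_on_dder[OF assms(2)] assms(1)] in auto)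

text \<open>The covariant derivative of the gradient of \<open>U\<close> along a coordinate field. It is the
  endomorphism that the metric associates to the Hessian, so the Laplacian is its trace.\<close>

definition cov_grad :: "('e \<Rightarrow> real) \<Rightarrow> 'e \<Rightarrow> 'e \<Rightarrow> 'e" where
  "cov_grad U x v = dder (loc_grad G U) x v + christoffel G x v (loc_grad G U x)"

lemma cov_grad_hess:
  assumes "x \<in> S" "smooth_on S U"
  shows "G x (cov_grad U x v) w = loc_hess G U x v w"
proof -
  have d: "U differentiable (at y)" if "y \<in> S" for y using assms smooth_on_differentiable that by blast
  have "dder (\<lambda>y. dder U y w) x v = dder (\<lambda>y. G y (loc_grad G U y) w) x v"
    using d by (intro dder_cong_open[OF open_dom assms(1)]) (simp add: loc_grad_works)
  also have "\<dots> = G x (cov_grad U x v) w + G x (loc_grad G U x) (christoffel G x v w)"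
    unfolding dder_metric_field(2)[OF assms(1) loc_grad_differentiable[OF assms]]
      christoffel_compatible[OF assms(1)]
    by (simp add: cov_grad_def bil_simps[OF assms(1)])
  finally show ?thesis using assms d by (simp add: loc_hess_def loc_grad_works)
qed

lemma trace_cov_grad:
  assumes "x \<in> S" "smooth_on S U"
  shows "metric_trace (G x) (loc_hess G U x) = (\<Sum>e\<in>Basis. cov_grad U x e \<bullet> e)"
proof -
  have "sharp (G x) (loc_hess G U x e) = cov_grad U x e" for e
    using sharp_eqI[OF bil nondeg] cov_grad_hess assms by blast
  then show ?thesis by (simp add: metric_trace_def)
qed

lemma linear_hess:
  assumes "x \<in> S" "smooth_on S U"
  shows "linear (loc_hess G U x v)"
proof -
  have "loc_hess G U x v = G x (cov_grad U x v)" using cov_grad_hess[OF assms] by (simp add: fun_eq_iff)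
  then show ?thesis using bil[OF assms(1)] by (simp add: bilinear_def)
qed

lemma grad_prod_dder:
  assumes "x \<in> S" "V differentiable (at x)"
  shows "G x (loc_grad G U x) (loc_grad G V x) = dder V x (loc_grad G U x)"
  using loc_grad_works[OF assms] sym[OF assms(1)] by metis

lemma zero_args:
  assumes "x \<in> S"
  shows "G x 0 v = 0" "G x v 0 = 0" "christoffel G x 0 v = 0" "christoffel G x v 0 = 0"
    "dder (\<lambda>y. G y v w) x 0 = 0" "dder (\<lambda>y. G y 0 w) x a = 0"
    "dder (\<lambda>y. christoffel G y v w) x 0 = 0" "dder (\<lambda>y. christoffel G y 0 w) x a = 0"
proof -
  have c: "christoffel G y 0 v = 0" if "y \<in> S" for y v
    using christoffel_scale_left[OF that, of 0 0] by simp
  show "G x 0 v = 0" "G x v 0 = 0"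
    using bil[OF assms] by (simp_all add: bilinear_lzero bilinear_rzero)
  show "christoffel G x 0 v = 0" "christoffel G x v 0 = 0"
    using c[OF assms] christoffel_sym[OF assms, of v 0] by simp_all
  show "dder (\<lambda>y. G y v w) x 0 = 0" "dder (\<lambda>y. christoffel G y v w) x 0 = 0"
    by (simp_all add: dder_zero christoffel_differentiable metric_differentiable assms)
  show "dder (\<lambda>y. G y 0 w) x a = 0" using dder_metric_linear(2)[OF assms, of 0 0] by simp
  have "dder (\<lambda>y. christoffel G y 0 w) x a = dder (\<lambda>_. 0) x a"
    using c by (intro dder_cong_open[OF open_dom assms]) auto
  then show "dder (\<lambda>y. christoffel G y 0 w) x a = 0" by (simp add: dder_def)
qed

lemma ricci_zero:
  assumes "x \<in> S"
  shows "loc_ricci G x 0 0 = 0"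
proof -
  have "dder (\<lambda>y. christoffel G y b 0) x a = dder (\<lambda>y. christoffel G y 0 b) x a" for a b
    by (rule dder_cong_open[OF open_dom assms]) (rule christoffel_sym)
  then show ?thesis by (simp add: loc_ricci_def curvature_def zero_args[OF assms])
qed

end
section \<open>The warped product in coordinates\<close>

lemma sum_Basis_prod:
  fixes h :: "'e::euclidean_space \<times> 'k::euclidean_space \<Rightarrow> 'c::comm_monoid_add"
  shows "sum h Basis = (\<Sum>b\<in>Basis. h (b, 0)) + (\<Sum>b\<in>Basis. h (0, b))"
proof -
  have "inj_on (\<lambda>u. (u::'e, 0::'k)) Basis" "inj_on (\<lambda>u. (0::'e, u::'k)) Basis"
    by (auto intro!: inj_onI)
  then show ?thesis
    unfolding Basis_prod_def
    by (subst sum.union_disjoint) (auto simp: Basis_prod_def sum.reindex)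
qed

text \<open>Coordinate expressions \<open>GB\<close>, \<open>GF\<close> and \<open>f\<close> of the two metrics and of the warping function, and a
  family of forms \<open>G\<close> that agrees with the warped metric on \<open>S \<times> T\<close>. The values of \<open>G\<close> outside
  \<open>S \<times> T\<close> do not matter.\<close>

locale warped_local =
  B: local_metric S GB + F: local_metric T GF
  for S :: "'e::euclidean_space set" and GB and T :: "'k::euclidean_space set" and GF +
  fixes f :: "'e \<Rightarrow> real" and G :: "'e \<times> 'k \<Rightarrow> 'e \<times> 'k \<Rightarrow> 'e \<times> 'k \<Rightarrow> real"
  assumes f_smooth: "smooth_on S f" and f_pos: "x \<in> S \<Longrightarrow> f x > 0"
    and warped: "x \<in> S \<Longrightarrow> y \<in> T \<Longrightarrow>
      G (x, y) (v1, v2) (w1, w2) = GB x v1 w1 + (f x)\<^sup>2 * GF y v2 w2"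
begin

lemma open_Times_dom: "open (S \<times> T)"
  using B.open_dom F.open_dom by (rule open_Times)

lemma warped_form: "z \<in> S \<times> T \<Longrightarrow>
    G z v w = GB (fst z) (fst v) (fst w) + (f (fst z))\<^sup>2 * GF (snd z) (snd v) (snd w)"
  using warped by (cases z; cases v; cases w) auto

lemma local_metric_warped: "local_metric (S \<times> T) G"
proof
  show "open (S \<times> T)" by (rule open_Times_dom)
next
  fix z v w assume z: "z \<in> S \<times> T"
  then have xy: "fst z \<in> S" "snd z \<in> T" by auto
  show "bilinear (G z)"
    unfolding bilinear_def
    by (auto intro!: linearI simp: warped_form z B.bil_simps[OF xy(1)] F.bil_simps[OF xy(2)] algebra_simps)
  show "G z v w = G z w v"
    by (simp add: warped_form z B.sym[OF xy(1), of "fst v"] F.sym[OF xy(2), of "snd v"])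
  show "nondegenerate_form (G z)"
    unfolding nondegenerate_form_def
  proof (intro allI impI)
    fix v assume v: "\<forall>w. G z v w = 0"
    have "GB (fst z) (fst v) w = 0" for w
      using v[THEN spec, of "(w, 0)"] F.bil_simps(4)[OF xy(2), of _ 0 0] by (simp add: warped_form z)
    moreover have "GF (snd z) (snd v) w = 0" for w
      using v[THEN spec, of "(0, w)"] B.bil_simps(4)[OF xy(1), of _ 0 0] f_pos[OF xy(1)]
      by (simp add: warped_form z)
    ultimately show "v = 0"
      using B.nondeg[OF xy(1)] F.nondeg[OF xy(2)] unfolding nondegenerate_form_def
      by (simp add: prod_eq_iff)
  qed
next
  fix v w
  have B: "smooth_on (S \<times> T) (\<lambda>z. F (fst z))" if "smooth_on S F" for F :: "'e \<Rightarrow> real"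
    by (rule smooth_on_compose_linear[OF open_Times_dom _ _ that]) (auto simp: linear_iff)
  have F: "smooth_on (S \<times> T) (\<lambda>z. F (snd z))" if "smooth_on T F" for F :: "'k \<Rightarrow> real"
    by (rule smooth_on_compose_linear[OF open_Times_dom _ _ that]) (auto simp: linear_iff)
  have "smooth_on (S \<times> T)
    (\<lambda>z. GB (fst z) (fst v) (fst w) + (f (fst z) * f (fst z)) * GF (snd z) (snd v) (snd w))"
    by (intro smooth_on_add smooth_on_mult open_Times_dom B[OF f_smooth]
        B[OF B.smooth] F[OF F.smooth])
  then show "smooth_on (S \<times> T) (\<lambda>z. G z v w)"
    by (subst smooth_on_cong[OF open_Times_dom]) (auto simp: warped_form power2_eq_square)
qed

sublocale P: local_metric "S \<times> T" G
  by (rule local_metric_warped)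

abbreviation "grad_f \<equiv> loc_grad GB f"

lemma has_derivative_fst_dder:
  "H differentiable (at x) \<Longrightarrow> ((\<lambda>p. H (fst p)) has_derivative (\<lambda>h. dder H x (fst h))) (at (x, y))"
  using has_derivative_compose[OF has_derivative_fst[OF has_derivative_ident], of H _ "(x,y)"]
    has_derivative_dder[of H x] by simp

lemma has_derivative_snd_dder:
  "H differentiable (at y) \<Longrightarrow> ((\<lambda>p. H (snd p)) has_derivative (\<lambda>h. dder H y (snd h))) (at (x, y))"
  using has_derivative_compose[OF has_derivative_snd[OF has_derivative_ident], of H _ "(x,y)"]
    has_derivative_dder[of H y] by simp

lemma f_differentiable: "x \<in> S \<Longrightarrow> f differentiable (at x)"
  and df_differentiable: "x \<in> S \<Longrightarrow> (\<lambda>y. dder f y v) differentiable (at x)"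
  using f_smooth smooth_on_differentiable smooth_on_dder by blast+

lemma dder_warped:
  assumes "x \<in> S" "y \<in> T"
  shows "dder (\<lambda>p. G p (v1, v2) (w1, w2)) (x, y) (a1, a2) =
    dder (\<lambda>x. GB x v1 w1) x a1 + 2 * f x * dder f x a1 * GF y v2 w2
      + (f x)\<^sup>2 * dder (\<lambda>y. GF y v2 w2) y a2"
proof -
  have 1: "dder (\<lambda>p. G p (v1, v2) (w1, w2)) (x, y) (a1, a2) =
      dder (\<lambda>p. GB (fst p) v1 w1 + (f (fst p))\<^sup>2 * GF (snd p) v2 w2) (x, y) (a1, a2)"
    by (rule dder_cong_open[OF open_Times_dom]) (use assms in \<open>auto simp: warped\<close>)
  have "((\<lambda>p. GB (fst p) v1 w1 + (f (fst p))\<^sup>2 * GF (snd p) v2 w2) has_derivative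
      (\<lambda>a. dder (\<lambda>x. GB x v1 w1) x (fst a) + 2 * f x * dder f x (fst a) * GF y v2 w2
        + (f x)\<^sup>2 * dder (\<lambda>y. GF y v2 w2) y (snd a))) (at (x, y))"
    by (auto intro!: derivative_eq_intros has_derivative_fst_dder[OF f_differentiable]
          has_derivative_fst_dder[OF B.metric_differentiable]
          has_derivative_snd_dder[OF F.metric_differentiable] assms simp: algebra_simps)
  from dder_eqI[OF this]
  have 2: "dder (\<lambda>p. GB (fst p) v1 w1 + (f (fst p))\<^sup>2 * GF (snd p) v2 w2) (x, y) (a1, a2) =
      dder (\<lambda>x. GB x v1 w1) x a1 + 2 * f x * dder f x a1 * GF y v2 w2
        + (f x)\<^sup>2 * dder (\<lambda>y. GF y v2 w2) y a2" by simp
  show ?thesis using 1 2 by simp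
qed

text \<open>The connection of the warped product: the fibres are umbilic with mean curvature proportional
  to the gradient of \<open>f\<close>, and horizontal fields act on vertical ones through \<open>df / f\<close>.\<close>

lemma christoffel_warped:
  assumes "x \<in> S" "y \<in> T"
  shows "christoffel G (x, y) (v1, v2) (w1, w2) =
    (christoffel GB x v1 w1 - (f x * GF y v2 w2) *\<^sub>R grad_f x,
     christoffel GF y v2 w2 + (dder f x v1 / f x) *\<^sub>R w2 + (dder f x w1 / f x) *\<^sub>R v2)"
    (is "_ = ?R")
proof (rule P.metric_unique)
  show xy: "(x, y) \<in> S \<times> T" using assms by simp
  fix z :: "'e \<times> 'k"
  obtain z1 z2 where z: "z = (z1, z2)" by fastforce
  show "G (x, y) (christoffel G (x, y) (v1, v2) (w1, w2)) z = G (x, y) ?R z"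
    using f_pos[OF assms(1)]
    by (simp add: z P.christoffel_koszul[OF xy] P.koszul_def dder_warped assms warped
        B.bil_simps[OF assms(1)] F.bil_simps[OF assms(2)] B.christoffel_koszul F.christoffel_koszul
        B.koszul_def F.koszul_def B.loc_grad_works f_differentiable)
       (simp add: field_simps power2_eq_square)
qed

lemma dder_christoffel_warped:
  assumes "x \<in> S" "y \<in> T"
  shows "dder (\<lambda>p. christoffel G p (v1, v2) (w1, w2)) (x, y) (a1, a2) =
    (dder (\<lambda>x. christoffel GB x v1 w1) x a1
       - (dder f x a1 * GF y v2 w2 + f x * dder (\<lambda>y. GF y v2 w2) y a2) *\<^sub>R grad_f x
       - (f x * GF y v2 w2) *\<^sub>R dder grad_f x a1,
     dder (\<lambda>y. christoffel GF y v2 w2) y a2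
       + (dder (\<lambda>x. dder f x v1) x a1 / f x - dder f x v1 * dder f x a1 / (f x)\<^sup>2) *\<^sub>R w2
       + (dder (\<lambda>x. dder f x w1) x a1 / f x - dder f x w1 * dder f x a1 / (f x)\<^sup>2) *\<^sub>R v2)"
proof -
  have 1: "dder (\<lambda>p. christoffel G p (v1, v2) (w1, w2)) (x, y) (a1, a2) = dder (\<lambda>p.
      (christoffel GB (fst p) v1 w1 - (f (fst p) * GF (snd p) v2 w2) *\<^sub>R grad_f (fst p),
       christoffel GF (snd p) v2 w2 + (dder f (fst p) v1 / f (fst p)) *\<^sub>R w2
         + (dder f (fst p) w1 / f (fst p)) *\<^sub>R v2)) (x, y) (a1, a2)"
    by (rule dder_cong_open[OF open_Times_dom])
       (use assms in \<open>auto simp: christoffel_warped simp del: scaleR_scaleR\<close>)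
  have cancel: "f x * (inverse (f x) * c) = c" for c using f_pos[OF assms(1)] by simp
  note d = has_derivative_fst_dder[OF B.christoffel_differentiable]
    has_derivative_snd_dder[OF F.christoffel_differentiable]
    has_derivative_snd_dder[OF F.metric_differentiable]
    has_derivative_fst_dder[OF B.loc_grad_differentiable[OF _ f_smooth]]
    has_derivative_fst_dder[OF f_differentiable] has_derivative_fst_dder[OF df_differentiable]
  have "((\<lambda>p.
      (christoffel GB (fst p) v1 w1 - (f (fst p) * GF (snd p) v2 w2) *\<^sub>R grad_f (fst p),
       christoffel GF (snd p) v2 w2 + (dder f (fst p) v1 / f (fst p)) *\<^sub>R w2
         + (dder f (fst p) w1 / f (fst p)) *\<^sub>R v2)) has_derivative
    (\<lambda>a. (dder (\<lambda>x. christoffel GB x v1 w1) x (fst a)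
       - (dder f x (fst a) * GF y v2 w2 + f x * dder (\<lambda>y. GF y v2 w2) y (snd a)) *\<^sub>R grad_f x
       - (f x * GF y v2 w2) *\<^sub>R dder grad_f x (fst a),
     dder (\<lambda>y. christoffel GF y v2 w2) y (snd a)
       + (dder (\<lambda>x. dder f x v1) x (fst a) / f x - dder f x v1 * dder f x (fst a) / (f x)\<^sup>2) *\<^sub>R w2
       + (dder (\<lambda>x. dder f x w1) x (fst a) / f x - dder f x w1 * dder f x (fst a) / (f x)\<^sup>2) *\<^sub>R v2)))
    (at (x, y))"
    using f_pos[OF assms(1)]
    by (auto intro!: derivative_eq_intros d assms simp del: scaleR_scaleR)
       (auto simp: fun_eq_iff algebra_simps power2_eq_square divide_inverse cancel)
  from dder_eqI[OF this, of "(a1, a2)"] show ?thesis unfolding 1 by simp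
qed

lemma df_zero:
  assumes "x \<in> S"
  shows "dder f x 0 = 0" "dder (\<lambda>x. dder f x v) x 0 = 0" "dder (\<lambda>x. dder f x 0) x a = 0"
    "dder grad_f x 0 = 0"
proof -
  have df: "dder f y 0 = 0" if "y \<in> S" for y
    by (simp add: dder_zero f_differentiable that)
  show "dder f x 0 = 0" "dder (\<lambda>x. dder f x v) x 0 = 0" "dder grad_f x 0 = 0"
    using df by (simp_all add: dder_zero df_differentiable B.loc_grad_differentiable f_smooth assms)
  have "dder (\<lambda>x. dder f x 0) x a = dder (\<lambda>_. 0) x a"
    using df by (intro dder_cong_open[OF B.open_dom assms]) auto
  then show "dder (\<lambda>x. dder f x 0) x a = 0" by (simp add: dder_def)
qed

lemmas horizontal_zero = df_zero B.zero_args
lemmas vertical_zero = F.zero_args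

text \<open>The two components of the curvature that enter the Ricci trace: the trace over the basis of
  \<open>'e \<times> 'k\<close> only needs the base component for horizontal \<open>b\<close> and the fibre component for
  vertical \<open>b\<close>. The remaining arguments are arbitrary, so mixed directions need no separate
  computation.\<close>

lemma curvature_horizontal:
  assumes "x \<in> S" "y \<in> T"
  shows "fst (curvature G (x, y) (b, 0) (v1, v2) (w1, w2)) =
    curvature GB x b v1 w1 - (f x * GF y v2 w2) *\<^sub>R B.cov_grad f x b"
  using f_pos[OF assms(1)]
  by (simp add: curvature_def dder_christoffel_warped christoffel_warped assms B.cov_grad_def
      horizontal_zero vertical_zero B.christoffel_simps F.bil_simps scaleR_add_left scaleR_add_right)

lemma hess_f_christoffel:
  assumes "x \<in> S"
  shows "dder f x (christoffel GB x v w) = dder (\<lambda>y. dder f y w) x v - loc_hess GB f x v w"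
  by (simp add: loc_hess_def)

lemma curvature_vertical:
  assumes "x \<in> S" "y \<in> T"
  shows "snd (curvature G (x, y) (0, b) (v1, v2) (w1, w2)) =
    curvature GF y b v2 w2 - (loc_hess GB f x v1 w1 / f x) *\<^sub>R b
      - GB x (grad_f x) (grad_f x) *\<^sub>R (GF y v2 w2 *\<^sub>R b - GF y b w2 *\<^sub>R v2)"
proof -
  have df: "dder f x (u - r *\<^sub>R u') = dder f x u - r * dder f x u'"
    "dder f x (- (r *\<^sub>R u)) = - r * dder f x u" for u u' r
    using linear_dder[OF f_differentiable[OF assms(1)]] by (simp_all add: linear_diff linear_scale linear_neg)
  have grad: "dder f x (grad_f x) = GB x (grad_f x) (grad_f x)"
    by (simp add: B.loc_grad_works f_differentiable assms)
  have cancel: "f x * (inverse (f x) * c) = c" for c using f_pos[OF assms(1)] by simp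
  show ?thesis
    using f_pos[OF assms(1)] F.christoffel_sym[OF assms(2), of b v2]
    by (simp add: curvature_def dder_christoffel_warped christoffel_warped assms df
        horizontal_zero vertical_zero F.christoffel_simps grad hess_f_christoffel)
       (simp add: algebra_simps power2_eq_square divide_inverse cancel)
qed

lemma ricci_warped:
  assumes "x \<in> S" "y \<in> T"
  shows "loc_ricci G (x, y) (v1, v2) (w1, w2) =
    loc_ricci GB x v1 w1 - real DIM('k) / f x * loc_hess GB f x v1 w1 + loc_ricci GF y v2 w2
      - (f x * metric_trace (GB x) (loc_hess GB f x)
          + (real DIM('k) - 1) * GB x (grad_f x) (grad_f x)) * GF y v2 w2"
proof -
  have "(\<Sum>b\<in>Basis. GF y b w2 * (v2 \<bullet> b)) = GF y v2 w2"
    using bilinear_sum_Basis[OF F.bil[OF assms(2)], of v2 w2] by (simp add: mult.commute)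
  then have "(\<Sum>b\<in>Basis. snd (curvature G (x, y) (0, b) (v1, v2) (w1, w2)) \<bullet> b) =
      loc_ricci GF y v2 w2 - real DIM('k) * (loc_hess GB f x v1 w1 / f x)
      - GB x (grad_f x) (grad_f x) * (real DIM('k) * GF y v2 w2 - GF y v2 w2)"
    by (simp add: curvature_vertical assms inner_diff_left sum_subtractf loc_ricci_def
        sum_distrib_left[symmetric])
  moreover have "(\<Sum>b\<in>Basis. fst (curvature G (x, y) (b, 0) (v1, v2) (w1, w2)) \<bullet> b) =
      loc_ricci GB x v1 w1 - f x * GF y v2 w2 * metric_trace (GB x) (loc_hess GB f x)"
    by (simp add: curvature_horizontal assms inner_diff_left sum_subtractf loc_ricci_def
        sum_distrib_left[symmetric] B.trace_cov_grad f_smooth)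
  ultimately show ?thesis
    unfolding loc_ricci_def[of G] sum_Basis_prod inner_Pair_0 by (simp add: algebra_simps)
qed

text \<open>From here on, \<open>U'\<close> is the lift to the product of a function \<open>U\<close> on the base or on the fibre.\<close>

lemma dder_horizontal:
  assumes "x \<in> S" "smooth_on S U" "\<And>x y. x \<in> S \<Longrightarrow> y \<in> T \<Longrightarrow> U' (x, y) = U x"
    and "y \<in> T"
  shows "dder U' (x, y) (a1, a2) = dder U x a1"
proof -
  have "dder U' (x, y) (a1, a2) = dder (\<lambda>p. U (fst p)) (x, y) (a1, a2)"
    using assms by (intro dder_cong_open[OF open_Times_dom]) auto
  then show ?thesis
    using dder_eqI[OF has_derivative_fst_dder] smooth_on_differentiable assms by (metis fst_conv)
qed

lemma dder_vertical:
  assumes "y \<in> T" "smooth_on T U" "\<And>x y. x \<in> S \<Longrightarrow> y \<in> T \<Longrightarrow> U' (x, y) = U y"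
    and "x \<in> S"
  shows "dder U' (x, y) (a1, a2) = dder U y a2"
proof -
  have "dder U' (x, y) (a1, a2) = dder (\<lambda>p. U (snd p)) (x, y) (a1, a2)"
    using assms by (intro dder_cong_open[OF open_Times_dom]) auto
  then show ?thesis
    using dder_eqI[OF has_derivative_snd_dder] smooth_on_differentiable assms by (metis snd_conv)
qed

lemma hess_horizontal:
  assumes "x \<in> S" "y \<in> T" "smooth_on S U" "\<And>x y. x \<in> S \<Longrightarrow> y \<in> T \<Longrightarrow> U' (x, y) = U x"
  shows "loc_hess G U' (x, y) (v1, v2) (w1, w2) =
    loc_hess GB U x v1 w1 + f x * GF y v2 w2 * GB x (grad_f x) (loc_grad GB U x)"
proof -
  have d: "U differentiable (at x)" using assms smooth_on_differentiable by blast
  have "dder U x (grad_f x) = GB x (grad_f x) (loc_grad GB U x)"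
    using B.loc_grad_works[OF assms(1) d] B.sym[OF assms(1)] by metis
  then show ?thesis
    using linear_dder[OF d]
    by (simp add: loc_hess_def christoffel_warped assms(1,2) dder_horizontal[OF assms(1,3,4,2)]
      dder_horizontal[OF assms(1) smooth_on_dder[OF assms(3)] dder_horizontal[OF _ assms(3,4)] assms(2)]
      linear_diff linear_scale)
qed

lemma hess_vertical:
  assumes "x \<in> S" "y \<in> T" "smooth_on T U" "\<And>x y. x \<in> S \<Longrightarrow> y \<in> T \<Longrightarrow> U' (x, y) = U y"
  shows "loc_hess G U' (x, y) (v1, v2) (w1, w2) =
    loc_hess GF U y v2 w2 - dder f x v1 / f x * dder U y w2 - dder f x w1 / f x * dder U y v2"
proof -
  have d: "U differentiable (at y)" using assms smooth_on_differentiable by blast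
  then show ?thesis
    using linear_dder[OF d]
    by (simp add: loc_hess_def christoffel_warped assms(1,2) dder_vertical[OF assms(2,3,4,1)]
      dder_vertical[OF assms(2) smooth_on_dder[OF assms(3)] dder_vertical[OF _ assms(3,4)] assms(1)]
      linear_add linear_scale)
qed

lemma sharp_warped:
  assumes "x \<in> S" "y \<in> T" "linear L"
  shows "sharp (G (x, y)) L =
    (sharp (GB x) (\<lambda>w. L (w, 0)), (1 / (f x)\<^sup>2) *\<^sub>R sharp (GF y) (\<lambda>w. L (0, w)))"
proof (rule sharp_eqI)
  have xy: "(x, y) \<in> S \<times> T" using assms by simp
  show "bilinear (G (x, y))" "nondegenerate_form (G (x, y))"
    using P.bil P.nondeg xy by auto
  fix w :: "'e \<times> 'k"
  obtain w1 w2 where w: "w = (w1, w2)" by fastforce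
  have "linear (\<lambda>w. L (w, 0))" "linear (\<lambda>w. L (0, w))"
    using linear_compose[of "\<lambda>w. (w, 0)" L] linear_compose[of "\<lambda>w. (0, w)" L] assms(3)
    by (auto simp: comp_def linear_iff)
  moreover have "L (w1, w2) = L (w1, 0) + L (0, w2)"
    using linear_add[OF assms(3), of "(w1, 0)" "(0, w2)"] by simp
  ultimately show "G (x, y) (sharp (GB x) (\<lambda>w. L (w, 0)), (1 / (f x)\<^sup>2) *\<^sub>R sharp (GF y) (\<lambda>w. L (0, w))) w = L w"
    using f_pos[OF assms(1)]
    by (simp add: w warped assms F.bil_simps[OF assms(2)]
        sharp_works[OF B.bil B.nondeg] sharp_works[OF F.bil F.nondeg])
qed

text \<open>The Hessian of a lift from the base has the fibre part \<open>f \<langle>\<nabla>f, \<nabla>U\<rangle> GF\<close>, whose trace gives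
  the extra first-order term.\<close>

lemma laplace_horizontal:
  assumes "x \<in> S" "y \<in> T" "smooth_on S U" "\<And>x y. x \<in> S \<Longrightarrow> y \<in> T \<Longrightarrow> U' (x, y) = U x"
  shows "metric_trace (G (x, y)) (loc_hess G U' (x, y)) =
    metric_trace (GB x) (loc_hess GB U x) + real DIM('k) / f x * GB x (grad_f x) (loc_grad GB U x)"
proof -
  have "smooth_on (S \<times> T) (\<lambda>p. U (fst p))"
    by (rule smooth_on_compose_linear[OF open_Times_dom _ _ assms(3)]) (auto simp: linear_iff)
  then have "smooth_on (S \<times> T) U'"
    using assms(4) by (subst smooth_on_cong[OF open_Times_dom]) auto
  then have lin: "linear (loc_hess G U' (x, y) v)" for v
    using P.linear_hess assms by auto
  have "sharp (GF y) (\<lambda>w. loc_hess G U' (x, y) (0, e) (0, w)) =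
      (f x * GB x (grad_f x) (loc_grad GB U x)) *\<^sub>R e" for e
    using linear_0[OF B.linear_hess[OF assms(1,3)]]
    by (intro sharp_eqI[OF F.bil F.nondeg] assms)
       (simp add: hess_horizontal[OF assms] F.bil_simps[OF assms(2)])
  moreover have "sharp (GB x) (\<lambda>w. loc_hess G U' (x, y) (e, 0) (w, 0)) = sharp (GB x) (loc_hess GB U x e)" for e
    by (simp add: hess_horizontal[OF assms] vertical_zero[OF assms(2)])
  ultimately show ?thesis
    using f_pos[OF assms(1)]
    by (simp add: metric_trace_def sum_Basis_prod sharp_warped[OF assms(1,2) lin] power2_eq_square)
qed

lemma laplace_vertical:
  assumes "x \<in> S" "y \<in> T" "smooth_on T U" "\<And>x y. x \<in> S \<Longrightarrow> y \<in> T \<Longrightarrow> U' (x, y) = U y"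
  shows "metric_trace (G (x, y)) (loc_hess G U' (x, y)) =
    metric_trace (GF y) (loc_hess GF U y) / (f x)\<^sup>2"
proof -
  have "smooth_on (S \<times> T) (\<lambda>p. U (snd p))"
    by (rule smooth_on_compose_linear[OF open_Times_dom _ _ assms(3)]) (auto simp: linear_iff)
  then have "smooth_on (S \<times> T) U'"
    using assms(4) by (subst smooth_on_cong[OF open_Times_dom]) auto
  then have lin: "linear (loc_hess G U' (x, y) v)" for v
    using P.linear_hess assms by auto
  have dU: "dder U y 0 = 0" using dder_zero smooth_on_differentiable assms by blast
  have "sharp (GB x) (\<lambda>w. loc_hess G U' (x, y) (e, 0) (w, 0)) = 0" for e
    using linear_0[OF F.linear_hess[OF assms(2,3)]]
    by (intro sharp_eqI[OF B.bil B.nondeg] assms)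
       (simp add: hess_vertical[OF assms] dU horizontal_zero[OF assms(1)])
  moreover have "sharp (GF y) (\<lambda>w. loc_hess G U' (x, y) (0, e) (0, w)) = sharp (GF y) (loc_hess GF U y e)" for e
    by (simp add: hess_vertical[OF assms] horizontal_zero[OF assms(1)])
  ultimately show ?thesis
    by (simp add: metric_trace_def sum_Basis_prod sharp_warped[OF assms(1,2) lin] sum_divide_distrib)
qed

lemma loc_grad_horizontal:
  assumes "x \<in> S" "y \<in> T" "smooth_on S U" "\<And>x y. x \<in> S \<Longrightarrow> y \<in> T \<Longrightarrow> U' (x, y) = U x"
  shows "loc_grad G U' (x, y) = (loc_grad GB U x, 0)"
proof -
  have d: "U differentiable (at x)" using assms smooth_on_differentiable by blast
  have "G (x, y) (loc_grad GB U x, 0) w = dder U' (x, y) w" for w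
    using dder_horizontal[OF assms(1,3,4,2)]
    by (cases w) (simp add: warped assms vertical_zero B.loc_grad_works d)
  then show ?thesis
    unfolding loc_grad_def[of G] using P.bil P.nondeg assms(1,2) by (intro sharp_eqI) auto
qed

lemma loc_grad_vertical:
  assumes "x \<in> S" "y \<in> T" "smooth_on T U" "\<And>x y. x \<in> S \<Longrightarrow> y \<in> T \<Longrightarrow> U' (x, y) = U y"
  shows "loc_grad G U' (x, y) = (0, (1 / (f x)\<^sup>2) *\<^sub>R loc_grad GF U y)"
proof -
  have d: "U differentiable (at y)" using assms smooth_on_differentiable by blast
  have "G (x, y) (0, (1 / (f x)\<^sup>2) *\<^sub>R loc_grad GF U y) w = dder U' (x, y) w" for w
    using dder_vertical[OF assms(2,3,4,1)] f_pos[OF assms(1)]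
    by (cases w) (simp add: warped assms horizontal_zero F.bil_simps[OF assms(2)] F.loc_grad_works d)
  then show ?thesis
    unfolding loc_grad_def[of G] using P.bil P.nondeg assms(1,2) by (intro sharp_eqI) auto
qed

lemma grad_prod_horizontal:
  assumes "x \<in> S" "y \<in> T" "smooth_on S U" "\<And>x y. x \<in> S \<Longrightarrow> y \<in> T \<Longrightarrow> U' (x, y) = U x"
    and "smooth_on S V" "\<And>x y. x \<in> S \<Longrightarrow> y \<in> T \<Longrightarrow> V' (x, y) = V x"
  shows "G (x, y) (loc_grad G U' (x, y)) (loc_grad G V' (x, y)) =
    GB x (loc_grad GB U x) (loc_grad GB V x)"
  by (simp add: loc_grad_horizontal[OF assms(1-4)] loc_grad_horizontal[OF assms(1,2,5,6)]
      warped assms(1,2) vertical_zero)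

lemma grad_prod_mixed:
  assumes "x \<in> S" "y \<in> T" "smooth_on T U" "\<And>x y. x \<in> S \<Longrightarrow> y \<in> T \<Longrightarrow> U' (x, y) = U y"
    and "smooth_on S V" "\<And>x y. x \<in> S \<Longrightarrow> y \<in> T \<Longrightarrow> V' (x, y) = V x"
  shows "G (x, y) (loc_grad G U' (x, y)) (loc_grad G V' (x, y)) = 0"
  by (simp add: loc_grad_vertical[OF assms(1-4)] loc_grad_horizontal[OF assms(1,2,5,6)]
      warped assms(1,2) vertical_zero horizontal_zero)

text \<open>The drift Laplacian with potential \<open>H - m log f\<close> collects the extra first-order term of the
  Laplacian of the warped product.\<close>

lemma drift_ln:
  assumes "x \<in> S" "smooth_on S U" "smooth_on S H"
    and "\<And>x. x \<in> S \<Longrightarrow> W x = H x - m * ln (f x)"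
  shows "GB x (loc_grad GB U x) (loc_grad GB W x) =
    GB x (loc_grad GB U x) (loc_grad GB H x) - m / f x * GB x (grad_f x) (loc_grad GB U x)"
proof -
  have dH: "H differentiable (at x)" using assms smooth_on_differentiable by blast
  have "((\<lambda>x. H x - m * ln (f x)) has_derivative (\<lambda>v. dder H x v - m / f x * dder f x v)) (at x)"
    using f_pos[OF assms(1)]
    by (auto intro!: derivative_eq_intros has_derivative_dder dH f_differentiable assms(1)
        simp: divide_inverse algebra_simps)
  then have W: "(W has_derivative (\<lambda>v. dder H x v - m / f x * dder f x v)) (at x)"
    by (rule has_derivative_transform_within_open[OF _ B.open_dom assms(1)]) (simp add: assms(4))
  then have "W differentiable (at x)" by (auto simp: differentiable_def)
  then show ?thesis
    by (simp add: B.grad_prod_dder assms(1) dH f_differentiable dder_eqI[OF W]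
        B.sym[OF assms(1), of "grad_f x"])
qed

end
section \<open>The index of a sum of forms\<close>

text \<open>Negative definite subspaces; the index of a form is their maximal dimension.\<close>

definition neg_def_on :: "('e::euclidean_space \<Rightarrow> 'e \<Rightarrow> real) \<Rightarrow> 'e set \<Rightarrow> bool" where
  "neg_def_on b W \<longleftrightarrow> subspace W \<and> (\<forall>w\<in>W. w \<noteq> 0 \<longrightarrow> b w w < 0)"

lemma finite_neg_def_dims: "finite {dim W |W. neg_def_on b (W :: 'e::euclidean_space set)}"
  by (rule finite_subset[of _ "{..DIM('e)}"]) (auto simp: dim_subset_UNIV)

lemma form_index_eq: "form_index b = Max {dim W |W. neg_def_on b W}"
  by (simp add: form_index_def neg_def_on_def)

text \<open>The index is determined by a negative definite subspace together with a positive
  semidefinite one of complementary dimension, because every negative definite subspace meets the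
  latter only in \<open>0\<close>.\<close>

lemma form_index_eqI:
  fixes b :: "'e::euclidean_space \<Rightarrow> 'e \<Rightarrow> real"
  assumes "neg_def_on b W" "subspace W'" "\<And>z. z \<in> W' \<Longrightarrow> b z z \<ge> 0" "dim W + dim W' = DIM('e)"
  shows "form_index b = dim W"
  unfolding form_index_eq
proof (rule Max_eqI[OF finite_neg_def_dims])
  fix k assume "k \<in> {dim W |W. neg_def_on b W}"
  then obtain Z where Z: "neg_def_on b Z" "k = dim Z" by auto
  have "Z \<inter> W' = {0}"
    using Z(1) assms(2,3) by (force simp: neg_def_on_def subspace_0)
  moreover have "dim {x + y |x y. x \<in> Z \<and> y \<in> W'} + dim (Z \<inter> W') = dim Z + dim W'"
    using Z(1) assms(2) by (intro dim_sums_Int) (auto simp: neg_def_on_def)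
  moreover have "dim {x + y |x y. x \<in> Z \<and> y \<in> W'} \<le> DIM('e)" by (rule dim_subset_UNIV)
  ultimately show "k \<le> dim W" using assms(4) Z(2) by simp
next
  show "dim W \<in> {dim W |W. neg_def_on b W}" using assms(1) by auto
qed

text \<open>For \<open>W\<close> negative definite of maximal dimension, its \<open>b\<close>-orthogonal complement \<open>W'\<close> is positive
  semidefinite: a negative vector in \<open>W'\<close> would enlarge \<open>W\<close>. Nondegeneracy gives the dimension of
  \<open>W'\<close>.\<close>

lemma index_decomposition:
  fixes b :: "'e::euclidean_space \<Rightarrow> 'e \<Rightarrow> real"
  assumes b: "bilinear b" "nondegenerate_form b" and sym: "\<And>v w. b v w = b w v"
  obtains W W' where "neg_def_on b W" "subspace W'" "\<And>z. z \<in> W' \<Longrightarrow> b z z \<ge> 0"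
    "dim W + dim W' = DIM('e)"
proof -
  have "neg_def_on b {0}" by (simp add: neg_def_on_def subspace_def)
  then have "{dim W |W. neg_def_on b W} \<noteq> {}" by auto
  from Max_in[OF finite_neg_def_dims this]
  obtain W where W: "neg_def_on b W" and max: "dim W = Max {dim W |W. neg_def_on b W}" by auto
  have le: "dim Z \<le> dim W" if "neg_def_on b Z" for Z
    unfolding max using that finite_neg_def_dims by (intro Max_ge) auto
  have subW: "subspace W" using W by (simp add: neg_def_on_def)
  define W' where "W' = {z. \<forall>w\<in>W. b z w = 0}"
  have subW': "subspace W'"
    unfolding W'_def subspace_def
    by (auto simp: bilinear_ladd[OF b(1)] bilinear_lmul[OF b(1)] bilinear_lzero[OF b(1)])
  have "b z z \<ge> 0" if "z \<in> W'" for z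
  proof (rule ccontr)
    assume neg: "\<not> b z z \<ge> 0"
    have zW: "b z w = 0" if "w \<in> W" for w using \<open>z \<in> W'\<close> that by (simp add: W'_def)
    then have "z \<notin> W" using neg by force
    define Z where "Z = {w + c *\<^sub>R z |w c. w \<in> W}"
    have "Z = {x + y |x y. x \<in> W \<and> y \<in> span {z}}"
      unfolding Z_def span_singleton by blast
    then have subZ: "subspace Z" using subspace_sums[OF subW subspace_span] by simp
    have "b v v < 0" if "v \<in> Z" "v \<noteq> 0" for v
    proof -
      obtain w c where v: "v = w + c *\<^sub>R z" "w \<in> W" using \<open>v \<in> Z\<close> unfolding Z_def by auto
      have eq: "b v v = b w w + c\<^sup>2 * b z z"
        using zW[OF v(2)] sym[of w z]
        by (simp add: v(1) bilinear_ladd[OF b(1)] bilinear_radd[OF b(1)] bilinear_lmul[OF b(1)]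
            bilinear_rmul[OF b(1)] power2_eq_square)
      show ?thesis
      proof (cases "c = 0")
        case True
        then show ?thesis using v W \<open>v \<noteq> 0\<close> by (auto simp: neg_def_on_def)
      next
        case False
        have "b w w \<le> 0" using W v(2) bilinear_lzero[OF b(1)] by (cases "w = 0") (auto simp: neg_def_on_def less_imp_le)
        moreover have "c\<^sup>2 * b z z < 0" using False neg by (simp add: mult_pos_neg)
        ultimately show ?thesis using eq by simp
      qed
    qed
    then have "dim Z \<le> dim W" using le subZ by (simp add: neg_def_on_def)
    moreover have "W \<subseteq> Z" unfolding Z_def by force
    ultimately have "W = Z" using subspace_dim_equal[OF subW subZ] by simp
    moreover have "z \<in> Z"
      unfolding Z_def using subspace_0[OF subW] by (auto intro!: exI[of _ 0] exI[of _ 1])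
    ultimately show False using \<open>z \<notin> W\<close> by simp
  qed
  moreover have "dim W + dim W' = DIM('e)"
  proof -
    note lin = linear_form_op[OF b(1)] and inj = inj_form_op[OF b]
    have "form_op b ` W' = {y \<in> UNIV. \<forall>w\<in>W. orthogonal w y}"
    proof (rule set_eqI)
      fix y
      obtain z where z: "y = form_op b z"
        using linear_injective_imp_surjective[OF lin inj] by (metis surjD)
      have "y \<in> form_op b ` W' \<longleftrightarrow> z \<in> W'" using inj z by (simp add: inj_image_mem_iff)
      then show "y \<in> form_op b ` W' \<longleftrightarrow> y \<in> {y \<in> UNIV. \<forall>w\<in>W. orthogonal w y}"
        by (simp add: W'_def z orthogonal_def form_op_inner[OF b(1)] inner_commute[of _ "form_op b z"])
    qed
    moreover have "dim (form_op b ` W') = dim W'"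
      using inj by (intro dim_image_eq lin) (auto intro: inj_on_subset)
    ultimately show ?thesis
      using dim_subspace_orthogonal_to_vectors[OF subW subspace_UNIV] by simp
  qed
  ultimately show thesis using that W subW' by blast
qed

lemma form_index_sum:
  fixes b :: "'e::euclidean_space \<Rightarrow> 'e \<Rightarrow> real" and b' :: "'k::euclidean_space \<Rightarrow> 'k \<Rightarrow> real"
  assumes b: "bilinear b" "nondegenerate_form b" "\<And>v w. b v w = b w v"
    and b': "bilinear b'" "nondegenerate_form b'" "\<And>v w. b' v w = b' w v"
    and r: "r > 0" and sum: "\<And>v w. g (v, w) (v, w) = b v v + r * b' w w"
  shows "form_index g = form_index b + form_index b'"
proof -
  obtain W Z where W: "neg_def_on b W" "subspace Z" "\<And>z. z \<in> Z \<Longrightarrow> b z z \<ge> 0" "dim W + dim Z = DIM('e)"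
    using index_decomposition[OF b] by blast
  obtain W' Z' where W': "neg_def_on b' W'" "subspace Z'" "\<And>z. z \<in> Z' \<Longrightarrow> b' z z \<ge> 0"
    "dim W' + dim Z' = DIM('k)"
    using index_decomposition[OF b'] by blast
  have sub: "subspace W" "subspace W'" using W W' by (auto simp: neg_def_on_def)
  have "neg_def_on g (W \<times> W')"
    unfolding neg_def_on_def
  proof (intro conjI ballI impI)
    show "subspace (W \<times> W')" using sub by (rule subspace_Times)
    fix w assume "w \<in> W \<times> W'" "w \<noteq> 0"
    then obtain u v where w: "w = (u, v)" "u \<in> W" "v \<in> W'" "u \<noteq> 0 \<or> v \<noteq> 0" by (auto simp: zero_prod_def)
    have "b u u \<le> 0" "r * b' v v \<le> 0" "b u u < 0 \<or> r * b' v v < 0"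
      using w W(1) W'(1) r bilinear_lzero[OF b(1)] bilinear_lzero[OF b'(1)]
      by (auto simp: neg_def_on_def mult_le_0_iff mult_less_0_iff less_imp_le order.order_iff_strict)
    then show "g w w < 0" using sum[of u v] w(1) by auto
  qed
  moreover have "g z z \<ge> 0" if "z \<in> Z \<times> Z'" for z
    using that W(3) W'(3) r by (cases z) (auto simp: sum)
  moreover have "dim (W \<times> W') + dim (Z \<times> Z') = DIM('e \<times> 'k)"
    using W W' sub by (simp add: dim_Times)
  ultimately have "form_index g = dim (W \<times> W')"
    using form_index_eqI subspace_Times W(2) W'(2) by blast
  then show ?thesis
    using form_index_eqI[OF W] form_index_eqI[OF W'] sub by (simp add: dim_Times)
qed

section \<open>Products of manifolds\<close>

text \<open>The charts of a product manifold are the products of charts.\<close>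

definition prod_chart :: "('p, 'e) chart \<Rightarrow> ('q, 'k) chart \<Rightarrow> ('p \<times> 'q, 'e \<times> 'k) chart" where
  "prod_chart c d = (fst c \<times> fst d, map_prod (snd c) (snd d))"

lemma atlas_prod: "atlas (prod_manifold M N) = {prod_chart c d |c d. c \<in> atlas M \<and> d \<in> atlas N}"
  and mtop_prod: "mtop (prod_manifold M N) = prod_topology (mtop M) (mtop N)"
  by (simp_all add: prod_manifold_def prod_chart_def)

lemma chart_props:
  assumes "smooth_manifold M" "c \<in> atlas M"
  shows "openin (mtop M) (fst c)" "fst c \<subseteq> carrier M" "open (snd c ` fst c)"
    "homeomorphic_map (subtopology (mtop M) (fst c)) (top_of_set (snd c ` fst c)) (snd c)"
    "inj_on (snd c) (fst c)"
proof -
  show o: "openin (mtop M) (fst c)" and "open (snd c ` fst c)"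
    and h: "homeomorphic_map (subtopology (mtop M) (fst c)) (top_of_set (snd c ` fst c)) (snd c)"
    using assms by (auto simp: smooth_manifold_def)
  show s: "fst c \<subseteq> carrier M" using o openin_subset by blast
  then show "inj_on (snd c) (fst c)"
    using homeomorphic_imp_injective_map[OF h] by (simp add: Int_absorb1)
qed

lemma chart_inv_chart:
  assumes "smooth_manifold M" "c \<in> atlas M" "p \<in> fst c"
  shows "chart_inv c (snd c p) = p"
  using chart_props(5)[OF assms(1,2)] assms(3) by (simp add: chart_inv_def)

lemma open_chart_image:
  assumes "smooth_manifold M" "c \<in> atlas M" "openin (mtop M) W"
  shows "open (snd c ` (fst c \<inter> W))"
proof -
  note h = chart_props[OF assms(1,2)]
  have "openin (subtopology (mtop M) (fst c)) (fst c \<inter> W)"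
    using assms(3) by (simp add: openin_subtopology_Int2)
  then have "openin (top_of_set (snd c ` fst c)) (snd c ` (fst c \<inter> W))"
    using h(4) homeomorphic_imp_open_map open_map_def by blast
  then show ?thesis using h(3) openin_open_trans by blast
qed

text \<open>The inverse of a product chart is only known on the image of its domain, so the later comparisons
  of coordinate expressions are made on such open images.\<close>

lemma chart_inv_prod:
  assumes "smooth_manifold M" "c \<in> atlas M" "smooth_manifold N" "d \<in> atlas N"
    and "x \<in> snd c ` fst c" "y \<in> snd d ` fst d"
  shows "chart_inv (prod_chart c d) (x, y) = (chart_inv c x, chart_inv d y)"
proof -
  obtain p q where pq: "p \<in> fst c" "q \<in> fst d" "x = snd c p" "y = snd d q" using assms by auto
  have "inj_on (map_prod (snd c) (snd d)) (fst c \<times> fst d)"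
    using chart_props(5)[OF assms(1,2)] chart_props(5)[OF assms(3,4)] by (rule map_prod_inj_on)
  from inv_into_f_f[OF this, of "(p, q)"]
  have "chart_inv (prod_chart c d) (x, y) = (p, q)"
    using pq by (simp add: chart_inv_def prod_chart_def)
  then show ?thesis using pq chart_inv_chart[OF assms(1,2)] chart_inv_chart[OF assms(3,4)] by simp
qed

lemma prod_chart_image:
  "snd (prod_chart c d) ` (fst (prod_chart c d) \<inter> V \<times> W) = snd c ` (fst c \<inter> V) \<times> snd d ` (fst d \<inter> W)"
  "snd (prod_chart c d) ` fst (prod_chart c d) = snd c ` fst c \<times> snd d ` fst d"
  by (auto simp: prod_chart_def map_prod_def image_iff) 

lemma second_countable_prod_topology:
  assumes "second_countable X" "second_countable Y"
  shows "second_countable (prod_topology X Y)"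
proof -
  obtain A where A: "countable A" "\<And>V. V \<in> A \<Longrightarrow> openin X V"
    "\<And>U x. openin X U \<Longrightarrow> x \<in> U \<Longrightarrow> \<exists>V\<in>A. x \<in> V \<and> V \<subseteq> U"
    using assms(1) unfolding second_countable_def by metis
  obtain B where B: "countable B" "\<And>V. V \<in> B \<Longrightarrow> openin Y V"
    "\<And>U x. openin Y U \<Longrightarrow> x \<in> U \<Longrightarrow> \<exists>V\<in>B. x \<in> V \<and> V \<subseteq> U"
    using assms(2) unfolding second_countable_def by metis
  show ?thesis
    unfolding second_countable_def
  proof (intro exI[of _ "(\<lambda>(V, W). V \<times> W) ` (A \<times> B)"] conjI ballI allI impI)
    show "countable ((\<lambda>(V, W). V \<times> W) ` (A \<times> B))" using A(1) B(1) by simp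
    show "openin (prod_topology X Y) V" if "V \<in> (\<lambda>(V, W). V \<times> W) ` (A \<times> B)" for V
      using that A(2) B(2) by (auto simp: openin_prod_Times_iff)
    fix U z assume U: "openin (prod_topology X Y) U \<and> z \<in> U"
    obtain x y where z: "z = (x, y)" by fastforce
    with U obtain V W where VW: "openin X V" "openin Y W" "x \<in> V" "y \<in> W" "V \<times> W \<subseteq> U"
      unfolding openin_prod_topology_alt by blast
    obtain V' W' where "V' \<in> A" "x \<in> V'" "V' \<subseteq> V" "W' \<in> B" "y \<in> W'" "W' \<subseteq> W"
      using A(3) B(3) VW by metis
    then show "\<exists>V\<in>(\<lambda>(V, W). V \<times> W) ` (A \<times> B). z \<in> V \<and> V \<subseteq> U"
      using VW z by (intro bexI[of _ "V' \<times> W'"]) auto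
  qed
qed

lemma homeomorphic_map_prod:
  assumes "homeomorphic_map X X' f" "homeomorphic_map Y Y' g"
  shows "homeomorphic_map (prod_topology X Y) (prod_topology X' Y') (map_prod f g)"
proof -
  obtain f' g' where "homeomorphic_maps X X' f f'" "homeomorphic_maps Y Y' g g'"
    using assms homeomorphic_map_maps by metis
  then show ?thesis
    using homeomorphic_maps_prod[of X Y X' Y' f g f' g'] unfolding homeomorphic_map_maps map_prod_def by blast
qed

lemma smooth_manifold_prod:
  assumes M: "smooth_manifold M" and N: "smooth_manifold N"
  shows "smooth_manifold (prod_manifold M N)"
  unfolding smooth_manifold_def
proof (intro conjI ballI)
  show "carrier (prod_manifold M N) \<noteq> {}" "Hausdorff_space (mtop (prod_manifold M N))"
    "second_countable (mtop (prod_manifold M N))"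
    using M N by (auto simp: smooth_manifold_def mtop_prod Hausdorff_space_prod_topology second_countable_prod_topology)
  show "(\<Union>c\<in>atlas (prod_manifold M N). fst c) = carrier (prod_manifold M N)"
  proof -
    have "(\<Union>c\<in>atlas (prod_manifold M N). fst c) = (\<Union>c\<in>atlas M. fst c) \<times> (\<Union>c\<in>atlas N. fst c)"
      by (force simp: atlas_prod prod_chart_def)
    then show ?thesis using M N by (simp add: smooth_manifold_def mtop_prod)
  qed
next
  fix c assume "c \<in> atlas (prod_manifold M N)"
  then obtain a b where c: "c = prod_chart a b" "a \<in> atlas M" "b \<in> atlas N" by (auto simp: atlas_prod)
  note A = chart_props[OF M c(2)] and B = chart_props[OF N c(3)]
  show "openin (mtop (prod_manifold M N)) (fst c)"
    using A(1) B(1) by (simp add: c(1) prod_chart_def mtop_prod openin_prod_Times_iff)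
  show "open (snd c ` fst c)" using A(3) B(3) by (simp add: c(1) prod_chart_image open_Times)
  show "homeomorphic_map (subtopology (mtop (prod_manifold M N)) (fst c)) (top_of_set (snd c ` fst c)) (snd c)"
    using homeomorphic_map_prod[OF A(4) B(4)]
    unfolding c(1) prod_chart_image mtop_prod by (simp add: prod_chart_def subtopology_Times)
next
  fix c d assume "c \<in> atlas (prod_manifold M N)" "d \<in> atlas (prod_manifold M N)"
  then obtain a b a' b' where cd: "c = prod_chart a b" "a \<in> atlas M" "b \<in> atlas N"
    "d = prod_chart a' b'" "a' \<in> atlas M" "b' \<in> atlas N" by (auto simp: atlas_prod)
  have im: "snd c ` (fst c \<inter> fst d) = snd a ` (fst a \<inter> fst a') \<times> snd b ` (fst b \<inter> fst b')"
    unfolding cd(1) using prod_chart_image(1)[of a b "fst a'" "fst b'"] by (simp add: cd(4) prod_chart_def)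
  have op: "open (snd a ` (fst a \<inter> fst a') \<times> snd b ` (fst b \<inter> fst b'))"
    using open_chart_image[OF M cd(2)] open_chart_image[OF N cd(3)] chart_props(1)[OF M cd(5)]
      chart_props(1)[OF N cd(6)] by (auto intro: open_Times)
  have sa: "smooth_on (snd a ` (fst a \<inter> fst a')) (snd a' \<circ> chart_inv a)"
    and sb: "smooth_on (snd b ` (fst b \<inter> fst b')) (snd b' \<circ> chart_inv b)"
    using M N cd by (auto simp: smooth_manifold_def)
  have "smooth_on (snd a ` (fst a \<inter> fst a') \<times> snd b ` (fst b \<inter> fst b'))
    (\<lambda>z. ((snd a' \<circ> chart_inv a) (fst z), (snd b' \<circ> chart_inv b) (snd z)))"
    by (intro smooth_on_Pair op smooth_on_compose_linear[OF op _ _ sa] smooth_on_compose_linear[OF op _ _ sb])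
       (auto simp: linear_iff)
  moreover have "(snd d \<circ> chart_inv c) z = ((snd a' \<circ> chart_inv a) (fst z), (snd b' \<circ> chart_inv b) (snd z))"
    if "z \<in> snd a ` (fst a \<inter> fst a') \<times> snd b ` (fst b \<inter> fst b')" for z
  proof -
    obtain x y where z: "z = (x, y)" by fastforce
    have "chart_inv c z = (chart_inv a x, chart_inv b y)"
      unfolding cd(1) z using that z by (intro chart_inv_prod[OF M cd(2) N cd(3)]) auto
    then show ?thesis by (simp add: cd(4) prod_chart_def z)
  qed
  ultimately show "smooth_on (snd c ` (fst c \<inter> fst d)) (snd d \<circ> chart_inv c)"
    unfolding im by (subst smooth_on_cong[OF op]) auto
qed

section \<open>Lifting functions and tangent vectors to a product\<close>

lemma smooth_fun_near:
  assumes "smooth_manifold M" "smooth_fun M u" "p \<in> carrier M"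
  shows "smooth_near M p u"
  unfolding smooth_near_def
proof (intro exI[of _ "carrier M"] conjI ballI)
  fix c assume c: "c \<in> atlas M"
  then have "fst c \<inter> carrier M = fst c" using chart_props(2)[OF assms(1)] by blast
  then show "smooth_on (snd c ` (fst c \<inter> carrier M)) (u \<circ> chart_inv c)"
    using assms(2) c by (simp add: smooth_fun_def)
qed (use assms in auto)

lemma open_prod_chart_image:
  assumes "smooth_manifold M" "smooth_manifold N" "c \<in> atlas M" "d \<in> atlas N"
    and "openin (mtop M) V" "openin (mtop N) W"
  shows "open (snd c ` (fst c \<inter> V) \<times> snd d ` (fst d \<inter> W))"
  by (intro open_Times open_chart_image[OF assms(1,3,5)] open_chart_image[OF assms(2,4,6)])

lemma smooth_on_base:
  assumes "smooth_manifold M" "smooth_manifold N" "c \<in> atlas M" "d \<in> atlas N"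
    and "openin (mtop M) V" "openin (mtop N) W"
    and "smooth_on (snd c ` (fst c \<inter> V)) (u \<circ> chart_inv c)"
  shows "smooth_on (snd c ` (fst c \<inter> V) \<times> snd d ` (fst d \<inter> W)) ((u \<circ> fst) \<circ> chart_inv (prod_chart c d))"
proof -
  note op = open_prod_chart_image[OF assms(1-6)]
  have "smooth_on (snd c ` (fst c \<inter> V) \<times> snd d ` (fst d \<inter> W)) (\<lambda>z. (u \<circ> chart_inv c) (fst z))"
    by (rule smooth_on_compose_linear[OF op _ _ assms(7)]) (auto simp: linear_iff)
  moreover have "((u \<circ> fst) \<circ> chart_inv (prod_chart c d)) z = (u \<circ> chart_inv c) (fst z)"
    if "z \<in> snd c ` (fst c \<inter> V) \<times> snd d ` (fst d \<inter> W)" for z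
    using that chart_inv_prod[OF assms(1,3,2,4), of "fst z" "snd z"] by (cases z) auto
  ultimately show ?thesis by (subst smooth_on_cong[OF op]) auto
qed

lemma smooth_on_fibre:
  assumes "smooth_manifold M" "smooth_manifold N" "c \<in> atlas M" "d \<in> atlas N"
    and "openin (mtop M) V" "openin (mtop N) W"
    and "smooth_on (snd d ` (fst d \<inter> W)) (u \<circ> chart_inv d)"
  shows "smooth_on (snd c ` (fst c \<inter> V) \<times> snd d ` (fst d \<inter> W)) ((u \<circ> snd) \<circ> chart_inv (prod_chart c d))"
proof -
  note op = open_prod_chart_image[OF assms(1-6)]
  have "smooth_on (snd c ` (fst c \<inter> V) \<times> snd d ` (fst d \<inter> W)) (\<lambda>z. (u \<circ> chart_inv d) (snd z))"
    by (rule smooth_on_compose_linear[OF op _ _ assms(7)]) (auto simp: linear_iff)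
  moreover have "((u \<circ> snd) \<circ> chart_inv (prod_chart c d)) z = (u \<circ> chart_inv d) (snd z)"
    if "z \<in> snd c ` (fst c \<inter> V) \<times> snd d ` (fst d \<inter> W)" for z
    using that chart_inv_prod[OF assms(1,3,2,4), of "fst z" "snd z"] by (cases z) auto
  ultimately show ?thesis by (subst smooth_on_cong[OF op]) auto
qed

text \<open>A function that is smooth near a point lifts to one that is smooth near the points of the product
  above it. This is what allows coordinate vectors, which are \<open>0\<close> on functions that are not smooth
  near the point, to be compared with their projections.\<close>

lemma smooth_near_base:
  assumes "smooth_manifold M" "smooth_manifold N" "smooth_near M p u" "q \<in> carrier N"
  shows "smooth_near (prod_manifold M N) (p, q) (u \<circ> fst)"
proof -
  obtain V where V: "openin (mtop M) V" "p \<in> V" "\<And>c. c \<in> atlas M \<Longrightarrow> smooth_on (snd c ` (fst c \<inter> V)) (u \<circ> chart_inv c)"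
    using assms(3) by (auto simp: smooth_near_def)
  show ?thesis
    unfolding smooth_near_def
  proof (intro exI[of _ "V \<times> carrier N"] conjI ballI)
    show "openin (mtop (prod_manifold M N)) (V \<times> carrier N)"
      using V(1) by (simp add: mtop_prod openin_prod_Times_iff)
    fix e assume "e \<in> atlas (prod_manifold M N)"
    then obtain c d where e: "e = prod_chart c d" "c \<in> atlas M" "d \<in> atlas N" by (auto simp: atlas_prod)
    show "smooth_on (snd e ` (fst e \<inter> V \<times> carrier N)) ((u \<circ> fst) \<circ> chart_inv e)"
      unfolding e(1) prod_chart_image
      by (rule smooth_on_base[OF assms(1,2) e(2,3) V(1) openin_topspace V(3)[OF e(2)]])
  qed (use V assms(4) in auto)
qed

lemma smooth_near_fibre:
  assumes "smooth_manifold M" "smooth_manifold N" "smooth_near N q u" "p \<in> carrier M"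
  shows "smooth_near (prod_manifold M N) (p, q) (u \<circ> snd)"
proof -
  obtain W where W: "openin (mtop N) W" "q \<in> W" "\<And>d. d \<in> atlas N \<Longrightarrow> smooth_on (snd d ` (fst d \<inter> W)) (u \<circ> chart_inv d)"
    using assms(3) by (auto simp: smooth_near_def)
  show ?thesis
    unfolding smooth_near_def
  proof (intro exI[of _ "carrier M \<times> W"] conjI ballI)
    show "openin (mtop (prod_manifold M N)) (carrier M \<times> W)"
      using W(1) by (simp add: mtop_prod openin_prod_Times_iff)
    fix e assume "e \<in> atlas (prod_manifold M N)"
    then obtain c d where e: "e = prod_chart c d" "c \<in> atlas M" "d \<in> atlas N" by (auto simp: atlas_prod)
    show "smooth_on (snd e ` (fst e \<inter> carrier M \<times> W)) ((u \<circ> snd) \<circ> chart_inv e)"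
      unfolding e(1) prod_chart_image
      by (rule smooth_on_fibre[OF assms(1,2) e(2,3) openin_topspace W(1) W(3)[OF e(3)]])
  qed (use W assms(4) in auto)
qed

lemma smooth_fun_base:
  assumes "smooth_manifold M" "smooth_manifold N" "smooth_fun M u"
  shows "smooth_fun (prod_manifold M N) (u \<circ> fst)"
  unfolding smooth_fun_def
proof
  fix e assume "e \<in> atlas (prod_manifold M N)"
  then obtain c d where e: "e = prod_chart c d" "c \<in> atlas M" "d \<in> atlas N" by (auto simp: atlas_prod)
  have "fst c \<inter> carrier M = fst c" "fst d \<inter> carrier N = fst d"
    using chart_props(2) assms e by blast+
  then show "smooth_on (snd e ` fst e) ((u \<circ> fst) \<circ> chart_inv e)"
    using smooth_on_base[OF assms(1,2) e(2,3) openin_topspace openin_topspace, of u] assms(3) e(2)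
    by (simp add: e(1) prod_chart_image smooth_fun_def)
qed

lemma smooth_fun_fibre:
  assumes "smooth_manifold M" "smooth_manifold N" "smooth_fun N u"
  shows "smooth_fun (prod_manifold M N) (u \<circ> snd)"
  unfolding smooth_fun_def
proof
  fix e assume "e \<in> atlas (prod_manifold M N)"
  then obtain c d where e: "e = prod_chart c d" "c \<in> atlas M" "d \<in> atlas N" by (auto simp: atlas_prod)
  have "fst c \<inter> carrier M = fst c" "fst d \<inter> carrier N = fst d"
    using chart_props(2) assms e by blast+
  then show "smooth_on (snd e ` fst e) ((u \<circ> snd) \<circ> chart_inv e)"
    using smooth_on_fibre[OF assms(1,2) e(2,3) openin_topspace openin_topspace, of u] assms(3) e(3)
    by (simp add: e(1) prod_chart_image smooth_fun_def)
qed

lemma coord_vec_base: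
  assumes M: "smooth_manifold M" and N: "smooth_manifold N" and cd: "c \<in> atlas M" "d \<in> atlas N"
    and pq: "p \<in> fst c" "q \<in> fst d" and u: "smooth_near M p u"
  shows "coord_vec (prod_manifold M N) (prod_chart c d) (p, q) (v1, v2) (u \<circ> fst) = coord_vec M c p v1 u"
proof -
  obtain V where V: "openin (mtop M) V" "p \<in> V" "smooth_on (snd c ` (fst c \<inter> V)) (u \<circ> chart_inv c)"
    using u cd by (auto simp: smooth_near_def)
  have q: "q \<in> carrier N" using chart_props(2)[OF N cd(2)] pq by auto
  note op = open_prod_chart_image[OF M N cd V(1) openin_topspace]
  have x: "snd c p \<in> snd c ` (fst c \<inter> V)" using V(2) pq by auto
  have "dder ((u \<circ> fst) \<circ> chart_inv (prod_chart c d)) (snd c p, snd d q) (v1, v2) =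
      dder (\<lambda>z. (u \<circ> chart_inv c) (fst z)) (snd c p, snd d q) (v1, v2)"
    using x pq q chart_inv_prod[OF M cd(1) N cd(2)]
    by (intro dder_cong_open[OF op]) auto
  also have "\<dots> = dder (u \<circ> chart_inv c) (snd c p) v1"
    using dder_compose_linear(2)[of fst "u \<circ> chart_inv c" "(snd c p, snd d q)"]
      smooth_on_differentiable[OF V(3) x] by (simp add: linear_iff)
  finally show ?thesis
    using smooth_near_base[OF M N u q] u by (simp add: coord_vec_def prod_chart_def)
qed

lemma coord_vec_fibre:
  assumes M: "smooth_manifold M" and N: "smooth_manifold N" and cd: "c \<in> atlas M" "d \<in> atlas N"
    and pq: "p \<in> fst c" "q \<in> fst d" and u: "smooth_near N q u"
  shows "coord_vec (prod_manifold M N) (prod_chart c d) (p, q) (v1, v2) (u \<circ> snd) = coord_vec N d q v2 u"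
proof -
  obtain W where W: "openin (mtop N) W" "q \<in> W" "smooth_on (snd d ` (fst d \<inter> W)) (u \<circ> chart_inv d)"
    using u cd by (auto simp: smooth_near_def)
  have p: "p \<in> carrier M" using chart_props(2)[OF M cd(1)] pq by auto
  note op = open_prod_chart_image[OF M N cd openin_topspace W(1)]
  have y: "snd d q \<in> snd d ` (fst d \<inter> W)" using W(2) pq by auto
  have "dder ((u \<circ> snd) \<circ> chart_inv (prod_chart c d)) (snd c p, snd d q) (v1, v2) =
      dder (\<lambda>z. (u \<circ> chart_inv d) (snd z)) (snd c p, snd d q) (v1, v2)"
    using y pq p chart_inv_prod[OF M cd(1) N cd(2)]
    by (intro dder_cong_open[OF op]) auto
  also have "\<dots> = dder (u \<circ> chart_inv d) (snd d q) v2"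
    using dder_compose_linear(2)[of snd "u \<circ> chart_inv d" "(snd c p, snd d q)"]
      smooth_on_differentiable[OF W(3) y] by (simp add: linear_iff)
  finally show ?thesis
    using smooth_near_fibre[OF M N u p] u by (simp add: coord_vec_def prod_chart_def)
qed

text \<open>The differentials of the projections send the coordinate vector with coordinates \<open>(v1, v2)\<close> to
  those with coordinates \<open>v1\<close> and \<open>v2\<close>; hence the warped metric has the expected coordinate
  expression.\<close>

lemma push_coord_vec:
  assumes M: "smooth_manifold M" and N: "smooth_manifold N" and cd: "c \<in> atlas M" "d \<in> atlas N"
    and pq: "p \<in> fst c" "q \<in> fst d"
  shows "push M fst (p, q) (coord_vec (prod_manifold M N) (prod_chart c d) (p, q) (v1, v2)) = coord_vec M c p v1"
    and "push N snd (p, q) (coord_vec (prod_manifold M N) (prod_chart c d) (p, q) (v1, v2)) = coord_vec N d q v2"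
proof -
  show "push M fst (p, q) (coord_vec (prod_manifold M N) (prod_chart c d) (p, q) (v1, v2)) = coord_vec M c p v1"
  proof (rule ext)
    fix u
    show "push M fst (p, q) (coord_vec (prod_manifold M N) (prod_chart c d) (p, q) (v1, v2)) u = coord_vec M c p v1 u"
      using coord_vec_base[OF assms, of u v1 v2]
      by (cases "smooth_near M p u") (simp_all add: push_def coord_vec_def[of M c])
  qed
  show "push N snd (p, q) (coord_vec (prod_manifold M N) (prod_chart c d) (p, q) (v1, v2)) = coord_vec N d q v2"
  proof (rule ext)
    fix u
    show "push N snd (p, q) (coord_vec (prod_manifold M N) (prod_chart c d) (p, q) (v1, v2)) u = coord_vec N d q v2 u"
      using coord_vec_fibre[OF assms, of u v1 v2]
      by (cases "smooth_near N q u") (simp_all add: push_def coord_vec_def[of N d])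
  qed
qed

lemma ball_atlas_prod:
  "(\<forall>e\<in>atlas (prod_manifold M N). \<forall>z\<in>fst e. A e z) \<longleftrightarrow>
     (\<forall>c\<in>atlas M. \<forall>d\<in>atlas N. \<forall>p\<in>fst c. \<forall>q\<in>fst d. A (prod_chart c d) (p, q))"
proof -
  have "(\<forall>e\<in>atlas (prod_manifold M N). Q e) \<longleftrightarrow>
      (\<forall>c\<in>atlas M. \<forall>d\<in>atlas N. Q (prod_chart c d))" for Q
    unfolding atlas_prod by blast
  moreover have "fst (prod_chart c d) = fst c \<times> fst d" for c :: "('a, 'c) chart" and d :: "('b, 'd) chart"
    by (simp add: prod_chart_def)
  ultimately show ?thesis by simp
qed

section \<open>Warped products of manifolds\<close>

lemma loc_metric_at:
  assumes "smooth_manifold M" "c \<in> atlas M" "p \<in> fst c"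
  shows "loc_metric M g c (snd c p) v w = metr M g c p v w"
  using chart_inv_chart[OF assms] by (simp add: loc_metric_def metr_def)

lemma local_metric_iff:
  "local_metric S G \<longleftrightarrow> open S \<and> (\<forall>v w. smooth_on S (\<lambda>x. G x v w)) \<and>
     (\<forall>x\<in>S. bilinear (G x) \<and> (\<forall>v w. G x v w = G x w v) \<and> nondegenerate_form (G x))"
    (is "_ \<longleftrightarrow> _ \<and> ?smooth \<and> ?forms")
proof
  assume "local_metric S G"
  note m = local_metric.open_dom[OF this] local_metric.smooth[OF this] local_metric.bil[OF this]
    local_metric.sym[OF this] local_metric.nondeg[OF this]
  show "open S \<and> ?smooth \<and> ?forms"
  proof (intro conjI ballI allI)
    fix x v w assume x: "x \<in> S"
    show "bilinear (G x)" "nondegenerate_form (G x)" "G x v w = G x w v" by (rule m(3-5)[OF x])+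
  qed (rule m(1,2))+
next
  assume *: "open S \<and> ?smooth \<and> ?forms"
  have smooth: ?smooth by (rule conjunct1[OF conjunct2[OF *]])
  have forms: ?forms by (rule conjunct2[OF conjunct2[OF *]])
  show "local_metric S G"
  proof
    show "open S" by (rule conjunct1[OF *])
    show "smooth_on S (\<lambda>x. G x v w)" for v w by (rule smooth[THEN spec, THEN spec])
    fix x assume "x \<in> S"
    note x = bspec[OF forms this]
    show "bilinear (G x)" by (rule conjunct1[OF x])
    show "nondegenerate_form (G x)" by (rule conjunct2[OF conjunct2[OF x]])
    show "G x v w = G x w v" for v w by (rule conjunct1[OF conjunct2[OF x], THEN spec, THEN spec])
  qed
qed

lemma semi_riemannian_iff:
  "semi_riemannian M g \<longleftrightarrow> smooth_manifold M \<and>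
     (\<forall>c\<in>atlas M. local_metric (snd c ` fst c) (loc_metric M g c)) \<and>
     (\<exists>\<nu>. \<forall>c\<in>atlas M. \<forall>x\<in>snd c ` fst c. form_index (loc_metric M g c x) = \<nu>)"
  unfolding semi_riemannian_def local_metric_iff
  by (intro conj_cong refl ball_cong iffI) (simp_all add: chart_props(3))

lemma semi_riemannian_manifold: "semi_riemannian M g \<Longrightarrow> smooth_manifold M"
  and semi_riemannian_local_metric:
    "semi_riemannian M g \<Longrightarrow> c \<in> atlas M \<Longrightarrow> local_metric (snd c ` fst c) (loc_metric M g c)"
  by (simp_all add: semi_riemannian_iff)

text \<open>The data of a warped product \<open>B \<times>\<^sub>f F\<close> of semi-Riemannian manifolds.\<close>

locale warped_product =
  fixes B :: "('p, 'e::euclidean_space) manifold" and gB :: "'p metric_field"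
    and F :: "('q, 'k::euclidean_space) manifold" and gF :: "'q metric_field"
    and f :: "'p \<Rightarrow> real"
  assumes srB: "semi_riemannian B gB" and srF: "semi_riemannian F gF"
    and smooth_f: "smooth_fun B f" and pos_f: "\<forall>p\<in>carrier B. f p > 0"
begin

abbreviation "M \<equiv> prod_manifold B F"
abbreviation "g \<equiv> warped_metric B gB F gF f"

lemma smB: "smooth_manifold B" and smF: "smooth_manifold F"
  using srB srF semi_riemannian_manifold by blast+

lemma metr_warped:
  assumes "c \<in> atlas B" "d \<in> atlas F" "p \<in> fst c" "q \<in> fst d"
  shows "metr M g (prod_chart c d) (p, q) (v1, v2) (w1, w2) =
    metr B gB c p v1 w1 + (f p)\<^sup>2 * metr F gF d q v2 w2"
  by (simp add: metr_def warped_metric_def pullback_def push_coord_vec[OF smB smF assms])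

lemma loc_metric_warped:
  assumes "c \<in> atlas B" "d \<in> atlas F" "x \<in> snd c ` fst c" "y \<in> snd d ` fst d"
  shows "loc_metric M g (prod_chart c d) (x, y) (v1, v2) (w1, w2) =
    loc_metric B gB c x v1 w1 + ((f \<circ> chart_inv c) x)\<^sup>2 * loc_metric F gF d y v2 w2"
proof -
  obtain p q where pq: "p \<in> fst c" "q \<in> fst d" "x = snd c p" "y = snd d q" using assms by auto
  then show ?thesis
    using metr_warped[OF assms(1,2) pq(1,2)] chart_inv_prod[OF smB assms(1) smF assms(2,3,4)]
      chart_inv_chart[OF smB assms(1)] chart_inv_chart[OF smF assms(2)]
    by (simp add: loc_metric_def metr_def)
qed

lemma warped_local_chart:
  assumes "c \<in> atlas B" "d \<in> atlas F"
  shows "warped_local (snd c ` fst c) (loc_metric B gB c) (snd d ` fst d) (loc_metric F gF d)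
    (f \<circ> chart_inv c) (loc_metric M g (prod_chart c d))"
proof -
  interpret B: local_metric "snd c ` fst c" "loc_metric B gB c"
    using semi_riemannian_local_metric[OF srB assms(1)] .
  interpret F: local_metric "snd d ` fst d" "loc_metric F gF d"
    using semi_riemannian_local_metric[OF srF assms(2)] .
  show ?thesis
  proof
    show "smooth_on (snd c ` fst c) (f \<circ> chart_inv c)" using smooth_f assms by (auto simp: smooth_fun_def)
    show "(f \<circ> chart_inv c) x > 0" if "x \<in> snd c ` fst c" for x
      using that chart_props(2)[OF smB assms(1)] pos_f chart_inv_chart[OF smB assms(1)] by auto
  qed (use loc_metric_warped[OF assms] in auto)
qed

lemma semi_riemannian_warped: "semi_riemannian M g"
  unfolding semi_riemannian_iff
proof (intro conjI ballI)
  show "smooth_manifold M" by (rule smooth_manifold_prod[OF smB smF])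
  show "local_metric (snd e ` fst e) (loc_metric M g e)" if e0: "e \<in> atlas M" for e
  proof -
    obtain c d where e: "e = prod_chart c d" "c \<in> atlas B" "d \<in> atlas F"
      using e0 by (auto simp: atlas_prod)
    show ?thesis
      unfolding e(1) prod_chart_image
      by (rule warped_local.local_metric_warped[OF warped_local_chart[OF e(2,3)]])
  qed
  obtain a where a: "\<And>c x. c \<in> atlas B \<Longrightarrow> x \<in> snd c ` fst c \<Longrightarrow> form_index (loc_metric B gB c x) = a"
    using srB unfolding semi_riemannian_iff by blast
  obtain b where b: "\<And>c x. c \<in> atlas F \<Longrightarrow> x \<in> snd c ` fst c \<Longrightarrow> form_index (loc_metric F gF c x) = b"
    using srF unfolding semi_riemannian_iff by blast
  have "form_index (loc_metric M g e z) = a + b" if e0: "e \<in> atlas M" and z0: "z \<in> snd e ` fst e" for e z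
  proof -
    obtain c d where e: "e = prod_chart c d" "c \<in> atlas B" "d \<in> atlas F" using e0 by (auto simp: atlas_prod)
    obtain x y where z: "z = (x, y)" "x \<in> snd c ` fst c" "y \<in> snd d ` fst d"
      using z0 unfolding e(1) prod_chart_image by auto
    interpret W: warped_local "snd c ` fst c" "loc_metric B gB c" "snd d ` fst d" "loc_metric F gF d"
        "f \<circ> chart_inv c" "loc_metric M g (prod_chart c d)"
      by (rule warped_local_chart[OF e(2,3)])
    have "form_index (loc_metric M g e z) = form_index (loc_metric B gB c x) + form_index (loc_metric F gF d y)"
      unfolding e(1) z(1)
    proof (rule form_index_sum[where r = "((f \<circ> chart_inv c) x)\<^sup>2"])
      show "((f \<circ> chart_inv c) x)\<^sup>2 > 0" by (rule zero_less_power[OF W.f_pos[OF z(2)]])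
    qed (rule W.B.bil W.B.nondeg W.B.sym W.F.bil W.F.nondeg W.F.sym W.warped; rule z)+
    then show ?thesis using a b e z by simp
  qed
  then show "\<exists>\<nu>. \<forall>c\<in>atlas M. \<forall>x\<in>snd c ` fst c. form_index (loc_metric M g c x) = \<nu>" by blast
qed

context
  fixes c d p q
  assumes chart: "c \<in> atlas B" "d \<in> atlas F" "p \<in> fst c" "q \<in> fst d"
begin

interpretation W: warped_local "snd c ` fst c" "loc_metric B gB c" "snd d ` fst d" "loc_metric F gF d"
    "f \<circ> chart_inv c" "loc_metric M g (prod_chart c d)"
  by (rule warped_local_chart[OF chart(1,2)])

lemma dom: "snd c p \<in> snd c ` fst c" "snd d q \<in> snd d ` fst d"
  using chart by auto

lemma at_chart: "snd (prod_chart c d) (p, q) = (snd c p, snd d q)"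
    "(f \<circ> chart_inv c) (snd c p) = f p"
    "loc_metric B gB c (snd c p) = metr B gB c p" "loc_metric F gF d (snd d q) = metr F gF d q"
  using chart_inv_chart[OF smB chart(1,3)] loc_metric_at[OF smB chart(1,3)] loc_metric_at[OF smF chart(2,4)]
  by (auto simp: prod_chart_def fun_eq_iff)

lemma base_fun:
  "x \<in> snd c ` fst c \<Longrightarrow> y \<in> snd d ` fst d \<Longrightarrow>
    (u \<circ> fst \<circ> chart_inv (prod_chart c d)) (x, y) = (u \<circ> chart_inv c) x"
  and fibre_fun:
  "x \<in> snd c ` fst c \<Longrightarrow> y \<in> snd d ` fst d \<Longrightarrow>
    (u' \<circ> snd \<circ> chart_inv (prod_chart c d)) (x, y) = (u' \<circ> chart_inv d) y"
  using chart_inv_prod[OF smB chart(1) smF chart(2)] by auto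

lemma smooth_chart:
  "smooth_fun B u \<Longrightarrow> smooth_on (snd c ` fst c) (u \<circ> chart_inv c)"
  "smooth_fun F u' \<Longrightarrow> smooth_on (snd d ` fst d) (u' \<circ> chart_inv d)"
  using chart by (auto simp: smooth_fun_def)

lemma Laplace_eq:
  "metric_trace (metr B gB c p) (loc_hess (loc_metric B gB c) (u \<circ> chart_inv c) (snd c p)) = Laplace B gB u c p"
  "metric_trace (metr F gF d q) (loc_hess (loc_metric F gF d) (u' \<circ> chart_inv d) (snd d q)) = Laplace F gF u' d q"
  by (simp_all add: Laplace_def at_chart(3,4)[symmetric] Hess_def[abs_def])

lemma Ric_warped:
  "Ric M g (prod_chart c d) (p, q) (v1, v2) (w1, w2) =
    Ric B gB c p v1 w1 - real DIM('k) / f p * Hess B gB f c p v1 w1 + Ric F gF d q v2 w2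
      - (f p * Laplace B gB f c p + (real DIM('k) - 1) * grad_prod B gB f f c p) * metr F gF d q v2 w2"
  using W.ricci_warped[OF dom, of v1 v2 w1 w2]
  by (simp add: Ric_def Hess_def grad_prod_def at_chart Laplace_eq del: comp_apply)

lemma Hess_base:
  assumes "smooth_fun B u"
  shows "Hess M g (u \<circ> fst) (prod_chart c d) (p, q) (v1, v2) (w1, w2) =
    Hess B gB u c p v1 w1 + f p * metr F gF d q v2 w2 * grad_prod B gB f u c p"
  using W.hess_horizontal[OF dom smooth_chart(1)[OF assms] base_fun, of v1 v2 w1 w2]
  by (simp add: Hess_def grad_prod_def at_chart del: comp_apply)

lemma Laplace_base:
  assumes "smooth_fun B u"
  shows "Laplace M g (u \<circ> fst) (prod_chart c d) (p, q) =
    Laplace B gB u c p + real DIM('k) / f p * grad_prod B gB f u c p"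
  using W.laplace_horizontal[OF dom smooth_chart(1)[OF assms] base_fun]
  by (simp add: Laplace_def[of M] Hess_def[of M, abs_def] grad_prod_def at_chart Laplace_eq del: comp_apply)

lemma Laplace_fibre:
  assumes "smooth_fun F u"
  shows "Laplace M g (u \<circ> snd) (prod_chart c d) (p, q) = Laplace F gF u d q / (f p)\<^sup>2"
  using W.laplace_vertical[OF dom smooth_chart(2)[OF assms] fibre_fun]
  by (simp add: Laplace_def[of M] Hess_def[of M, abs_def] grad_prod_def at_chart Laplace_eq del: comp_apply)

lemma grad_prod_base:
  assumes "smooth_fun B u" "smooth_fun B h"
  shows "grad_prod M g (u \<circ> fst) (h \<circ> fst) (prod_chart c d) (p, q) = grad_prod B gB u h c p"
  using W.grad_prod_horizontal[OF dom smooth_chart(1)[OF assms(1)] base_fun smooth_chart(1)[OF assms(2)] base_fun]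
  by (simp add: grad_prod_def at_chart(1) del: comp_apply)

lemma grad_prod_fibre_base:
  assumes "smooth_fun F u" "smooth_fun B h"
  shows "grad_prod M g (u \<circ> snd) (h \<circ> fst) (prod_chart c d) (p, q) = 0"
  using W.grad_prod_mixed[OF dom smooth_chart(2)[OF assms(1)] fibre_fun smooth_chart(1)[OF assms(2)] base_fun]
  by (simp add: grad_prod_def at_chart(1) del: comp_apply)

lemma drift_Laplace_ln:
  assumes "smooth_fun B u" "smooth_fun B h"
  shows "drift_Laplace B gB (\<lambda>x. h x - m * ln (f x)) u c p =
    Laplace B gB u c p + m / f p * grad_prod B gB f u c p - grad_prod B gB u h c p"
  using W.drift_ln[OF dom(1) smooth_chart(1)[OF assms(1)] smooth_chart(1)[OF assms(2)],
      of "(\<lambda>x. h x - m * ln (f x)) \<circ> chart_inv c" m] chart_inv_chart[OF smB chart(1,3)]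
  by (simp add: drift_Laplace_def grad_prod_def)

lemma grad_tensor_base:
  assumes "smooth_fun B u"
  shows "grad_tensor M (u \<circ> fst) (prod_chart c d) (p, q) (v1, v2) (w1, w2) = grad_tensor B u c p v1 w1"
  using coord_vec_base[OF smB smF chart smooth_fun_near[OF smB assms]] chart_props(2)[OF smB chart(1)] chart(3)
  by (auto simp: grad_tensor_def)

lemma grad_tensor_fibre:
  assumes "smooth_fun F u"
  shows "grad_tensor M (u \<circ> snd) (prod_chart c d) (p, q) (v1, v2) (w1, w2) = grad_tensor F u d q v2 w2"
  using coord_vec_fibre[OF smB smF chart smooth_fun_near[OF smF assms]] chart_props(2)[OF smF chart(2)] chart(4)
  by (auto simp: grad_tensor_def)

end

end

section \<open>Separation of the soliton equation\<close>

text \<open>At zero vectors all tensors vanish, which is used to separate the horizontal and the vertical part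
  of a tensor equation.\<close>

lemma tensors_zero:
  assumes "semi_riemannian M g" "c \<in> atlas M" "p \<in> fst c"
  shows "Ric M g c p 0 0 = 0" "metr M g c p 0 0 = 0" "smooth_fun M u \<Longrightarrow> Hess M g u c p 0 0 = 0"
    "smooth_fun M u \<Longrightarrow> grad_tensor M u c p 0 0 = 0"
proof -
  interpret local_metric "snd c ` fst c" "loc_metric M g c"
    using semi_riemannian_local_metric[OF assms(1,2)] .
  have x: "snd c p \<in> snd c ` fst c" using assms by auto
  have sm: "smooth_manifold M" by (rule semi_riemannian_manifold[OF assms(1)])
  show "Ric M g c p 0 0 = 0" by (simp add: Ric_def ricci_zero x)
  show "metr M g c p 0 0 = 0" using zero_args(1)[OF x, of 0] by (simp add: loc_metric_at[OF sm assms(2,3)])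
  assume "smooth_fun M u"
  then have u: "smooth_on (snd c ` fst c) (u \<circ> chart_inv c)" using assms by (simp add: smooth_fun_def)
  show "Hess M g u c p 0 0 = 0" using linear_0[OF linear_hess[OF x u]] by (simp add: Hess_def)
  show "grad_tensor M u c p 0 0 = 0"
    using dder_zero[OF smooth_on_differentiable[OF u x]] by (simp add: grad_tensor_def coord_vec_def)
qed

lemma metr_nonzero:
  fixes M :: "('p, 'e::euclidean_space) manifold"
  assumes "semi_riemannian M g" "c \<in> atlas M" "p \<in> fst c"
  obtains v w where "metr M g c p v w \<noteq> 0"
proof -
  interpret local_metric "snd c ` fst c" "loc_metric M g c"
    using semi_riemannian_local_metric[OF assms(1,2)] .
  have sm: "smooth_manifold M" by (rule semi_riemannian_manifold[OF assms(1)])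
  obtain v :: 'e where v: "v \<in> Basis" using nonempty_Basis by blast
  then have "v \<noteq> 0" by (rule nonzero_Basis)
  then obtain w where "loc_metric M g c (snd c p) v w \<noteq> 0"
    using nondeg[of "snd c p"] assms(3) unfolding nondegenerate_form_def by blast
  then show thesis using that loc_metric_at[OF sm assms(2,3)] by metis
qed

lemma manifold_point:
  assumes "smooth_manifold M"
  obtains c p where "c \<in> atlas M" "p \<in> fst c"
proof -
  have "carrier M \<noteq> {}" "(\<Union>c\<in>atlas M. fst c) = carrier M" using assms by (simp_all add: smooth_manifold_def)
  then show thesis using that by blast
qed

text \<open>Separation of variables. \<open>E\<close> and \<open>K\<close> live on the base, \<open>R\<close> and \<open>G\<close> on the fibre, and the pairs in \<open>P\<close>
  and \<open>Q\<close> consist of a chart and a point in its domain. Fixing a fibre vector pair with \<open>G \<noteq> 0\<close>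
  forces \<open>K\<close> to be a constant \<open>\<mu>\<close>.\<close>

lemma separate_tensor_equation:
  fixes E :: "'c \<Rightarrow> 'p \<Rightarrow> 'v::zero \<Rightarrow> 'v \<Rightarrow> real" and R G :: "'d \<Rightarrow> 'q \<Rightarrow> 'w::zero \<Rightarrow> 'w \<Rightarrow> real"
  assumes E0: "\<And>c p. (c, p) \<in> P \<Longrightarrow> E c p 0 0 = 0"
    and R0: "\<And>d q. (d, q) \<in> Q \<Longrightarrow> R d q 0 0 = 0" and G0: "\<And>d q. (d, q) \<in> Q \<Longrightarrow> G d q 0 0 = 0"
    and nz: "(d0, q0) \<in> Q" "G d0 q0 v0 w0 \<noteq> 0" and ne: "(c0, p0) \<in> P"
  shows "(\<forall>(c, p)\<in>P. \<forall>(d, q)\<in>Q. \<forall>v1 w1 v2 w2. E c p v1 w1 + R d q v2 w2 = K c p * G d q v2 w2) \<longleftrightarrow>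
    (\<exists>\<mu>. (\<forall>(c, p)\<in>P. \<forall>v w. E c p v w = 0) \<and> (\<forall>(d, q)\<in>Q. \<forall>v w. R d q v w = \<mu> * G d q v w) \<and>
         (\<forall>(c, p)\<in>P. K c p = \<mu>))" (is "?L \<longleftrightarrow> ?R")
proof
  assume ?L
  then have L: "E c p v1 w1 + R d q v2 w2 = K c p * G d q v2 w2"
    if "(c, p) \<in> P" "(d, q) \<in> Q" for c p d q v1 w1 v2 w2 using that by blast
  have E: "E c p v w = 0" if "(c, p) \<in> P" for c p v w
    using L[OF that nz(1), of v w 0 0] R0[OF nz(1)] G0[OF nz(1)] by simp
  have R: "R d q v w = K c p * G d q v w" if "(c, p) \<in> P" "(d, q) \<in> Q" for c p d q v w
    using L[OF that, of 0 0 v w] E0[OF that(1)] by simp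
  have "K c p = K c0 p0" if "(c, p) \<in> P" for c p
    using R[OF that nz(1), of v0 w0] R[OF ne nz(1), of v0 w0] nz(2) by simp
  then show ?R using E R[OF ne] by (intro exI[of _ "K c0 p0"]) auto
next
  assume ?R
  then obtain \<mu> where \<mu>: "\<forall>(c, p)\<in>P. \<forall>v w. E c p v w = 0"
    "\<forall>(d, q)\<in>Q. \<forall>v w. R d q v w = \<mu> * G d q v w" "\<forall>(c, p)\<in>P. K c p = \<mu>"
    by (elim exE conjE)
  have sum: "E c p v1 w1 + R d q v2 w2 = K c p * G d q v2 w2"
    if "(c, p) \<in> P" "(d, q) \<in> Q" for c p d q v1 w1 v2 w2
    using bspec[OF \<mu>(1) that(1)] bspec[OF \<mu>(2) that(2)] bspec[OF \<mu>(3) that(1)] by simp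
  show ?L by clarify (rule sum)
qed

theorem theorem1p3:
  fixes B :: "('p, 'e::euclidean_space) manifold" and g\<^sub>B :: "'p metric_field"
    and F :: "('q, 'k::euclidean_space) manifold" and g\<^sub>F :: "'q metric_field"
    and f h\<^sub>B :: "'p \<Rightarrow> real" and lam \<theta> :: real
  assumes "semi_riemannian B g\<^sub>B" and "semi_riemannian F g\<^sub>F"
    and "smooth_fun B f" and "\<forall>p\<in>carrier B. f p > 0"
    and "\<theta> \<ge> 0" and "smooth_fun B h\<^sub>B"
  shows
    "(\<forall>u\<^sub>B. smooth_fun B u\<^sub>B \<longrightarrow>
        (GRHS (prod_manifold B F) (warped_metric B g\<^sub>B F g\<^sub>F f) (h\<^sub>B \<circ> fst) (u\<^sub>B \<circ> fst) lam \<theta> \<longleftrightarrow>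
         (\<exists>\<mu>.
            (\<forall>c\<in>atlas B. \<forall>p\<in>fst c. \<forall>v w.
               Ric B g\<^sub>B c p v w - real DIM('k) / f p * Hess B g\<^sub>B f c p v w
                 + Hess B g\<^sub>B h\<^sub>B c p v w - \<theta> * grad_tensor B u\<^sub>B c p v w
               = lam * metr B g\<^sub>B c p v w) \<and>
            (\<forall>c\<in>atlas B. \<forall>p\<in>fst c.
               drift_Laplace B g\<^sub>B (\<lambda>x. h\<^sub>B x - real DIM('k) * ln (f x)) u\<^sub>B c p = 0) \<and>
            einstein F g\<^sub>F \<mu> \<and>
            (\<forall>c\<in>atlas B. \<forall>p\<in>fst c.
               f p * Laplace B g\<^sub>B f c p + (real DIM('k) - 1) * grad_prod B g\<^sub>B f f c p
                 + lam * (f p)^2 - f p * grad_prod B g\<^sub>B f h\<^sub>B c p = \<mu>)))) \<and>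
     (\<forall>u\<^sub>F. smooth_fun F u\<^sub>F \<longrightarrow>
        (GRHS (prod_manifold B F) (warped_metric B g\<^sub>B F g\<^sub>F f) (h\<^sub>B \<circ> fst) (u\<^sub>F \<circ> snd) lam \<theta> \<longleftrightarrow>
         (\<exists>\<mu>.
            (\<forall>c\<in>atlas B. \<forall>p\<in>fst c. \<forall>v w.
               Ric B g\<^sub>B c p v w - real DIM('k) / f p * Hess B g\<^sub>B f c p v w
                 + Hess B g\<^sub>B h\<^sub>B c p v w
               = lam * metr B g\<^sub>B c p v w) \<and>
            einstein_harmonic F g\<^sub>F \<theta> u\<^sub>F \<mu> \<and>
            (\<forall>c\<in>atlas B. \<forall>p\<in>fst c.
               f p * Laplace B g\<^sub>B f c p + (real DIM('k) - 1) * grad_prod B g\<^sub>B f f c p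
                 + lam * (f p)^2 - f p * grad_prod B g\<^sub>B f h\<^sub>B c p = \<mu>))))"
proof -
  interpret warped_product B g\<^sub>B F g\<^sub>F f
    by (rule warped_product.intro[OF assms(1-4)])
  let ?K = "\<lambda>c p. f p * Laplace B g\<^sub>B f c p + (real DIM('k) - 1) * grad_prod B g\<^sub>B f f c p
                 + lam * (f p)^2 - f p * grad_prod B g\<^sub>B f h\<^sub>B c p"
  let ?EB = "\<lambda>c p v w. Ric B g\<^sub>B c p v w - real DIM('k) / f p * Hess B g\<^sub>B f c p v w
                 + Hess B g\<^sub>B h\<^sub>B c p v w"
  let ?P = "{(c, p). c \<in> atlas B \<and> p \<in> fst c}" and ?Q = "{(d, q). d \<in> atlas F \<and> q \<in> fst d}"
  obtain c0 p0 where cp: "c0 \<in> atlas B" "p0 \<in> fst c0" using manifold_point[OF smB] .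
  obtain d0 q0 where dq: "d0 \<in> atlas F" "q0 \<in> fst d0" using manifold_point[OF smF] .
  obtain v0 w0 where nz: "metr F g\<^sub>F d0 q0 v0 w0 \<noteq> 0" using metr_nonzero[OF srF dq] .
  note zeroB = tensors_zero[OF srB] and zeroF = tensors_zero[OF srF]
  have f_pos: "f p > 0" if "c \<in> atlas B" "p \<in> fst c" for c p
    using pos_f chart_props(2)[OF smB that(1)] that(2) by blast
  show ?thesis
  proof (intro conjI allI impI)
    fix u assume u: "smooth_fun B u"
    let ?E = "\<lambda>c p v w. ?EB c p v w - \<theta> * grad_tensor B u c p v w - lam * metr B g\<^sub>B c p v w"
    have "(\<forall>e\<in>atlas M. \<forall>z\<in>fst e. \<forall>v w. Ric M g e z v w + Hess M g (h\<^sub>B \<circ> fst) e z v w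
        - \<theta> * grad_tensor M (u \<circ> fst) e z v w = lam * metr M g e z v w) \<longleftrightarrow>
      (\<forall>(c, p)\<in>?P. \<forall>(d, q)\<in>?Q. \<forall>v1 w1 v2 w2.
        ?E c p v1 w1 + Ric F g\<^sub>F d q v2 w2 = ?K c p * metr F g\<^sub>F d q v2 w2)"
      unfolding ball_atlas_prod
      by (auto simp: Ric_warped Hess_base grad_tensor_base metr_warped u assms(6) algebra_simps)
    also have "\<dots> \<longleftrightarrow> (\<exists>\<mu>. (\<forall>(c, p)\<in>?P. \<forall>v w. ?E c p v w = 0) \<and>
      (\<forall>(d, q)\<in>?Q. \<forall>v w. Ric F g\<^sub>F d q v w = \<mu> * metr F g\<^sub>F d q v w) \<and> (\<forall>(c, p)\<in>?P. ?K c p = \<mu>))"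
      by (rule separate_tensor_equation[of _ _ _ _ _ d0 q0 v0 w0 c0 p0])
         (use cp dq nz zeroB zeroF u assms(3,6) in auto)
    finally have tensor: "(\<forall>e\<in>atlas M. \<forall>z\<in>fst e. \<forall>v w. Ric M g e z v w + Hess M g (h\<^sub>B \<circ> fst) e z v w
        - \<theta> * grad_tensor M (u \<circ> fst) e z v w = lam * metr M g e z v w) \<longleftrightarrow>
      (\<exists>\<mu>. (\<forall>c\<in>atlas B. \<forall>p\<in>fst c. \<forall>v w.
         ?EB c p v w - \<theta> * grad_tensor B u c p v w = lam * metr B g\<^sub>B c p v w) \<and>
        einstein F g\<^sub>F \<mu> \<and> (\<forall>c\<in>atlas B. \<forall>p\<in>fst c. ?K c p = \<mu>))"
      by (auto simp: einstein_def)
    have harmonic: "(\<forall>e\<in>atlas M. \<forall>z\<in>fst e. Laplace M g (u \<circ> fst) e z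
        - grad_prod M g (u \<circ> fst) (h\<^sub>B \<circ> fst) e z = 0) \<longleftrightarrow>
      (\<forall>c\<in>atlas B. \<forall>p\<in>fst c. drift_Laplace B g\<^sub>B (\<lambda>x. h\<^sub>B x - real DIM('k) * ln (f x)) u c p = 0)"
      unfolding ball_atlas_prod using dq
      by (auto simp: Laplace_base grad_prod_base drift_Laplace_ln[OF _ dq(1) _ dq(2)] u assms(6))
    show "GRHS M g (h\<^sub>B \<circ> fst) (u \<circ> fst) lam \<theta> \<longleftrightarrow>
         (\<exists>\<mu>.
            (\<forall>c\<in>atlas B. \<forall>p\<in>fst c. \<forall>v w.
               ?EB c p v w - \<theta> * grad_tensor B u c p v w = lam * metr B g\<^sub>B c p v w) \<and>
            (\<forall>c\<in>atlas B. \<forall>p\<in>fst c.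
               drift_Laplace B g\<^sub>B (\<lambda>x. h\<^sub>B x - real DIM('k) * ln (f x)) u c p = 0) \<and>
            einstein F g\<^sub>F \<mu> \<and> (\<forall>c\<in>atlas B. \<forall>p\<in>fst c. ?K c p = \<mu>))"
      unfolding GRHS_def tensor harmonic
      using semi_riemannian_warped smooth_fun_base[OF smB smF] u assms(5,6) by blast
  next
    fix u assume u: "smooth_fun F u"
    let ?E = "\<lambda>c p v w. ?EB c p v w - lam * metr B g\<^sub>B c p v w"
    let ?R = "\<lambda>d q v w. Ric F g\<^sub>F d q v w - \<theta> * grad_tensor F u d q v w"
    have "(\<forall>e\<in>atlas M. \<forall>z\<in>fst e. \<forall>v w. Ric M g e z v w + Hess M g (h\<^sub>B \<circ> fst) e z v w
        - \<theta> * grad_tensor M (u \<circ> snd) e z v w = lam * metr M g e z v w) \<longleftrightarrow>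
      (\<forall>(c, p)\<in>?P. \<forall>(d, q)\<in>?Q. \<forall>v1 w1 v2 w2.
        ?E c p v1 w1 + ?R d q v2 w2 = ?K c p * metr F g\<^sub>F d q v2 w2)"
      unfolding ball_atlas_prod
      by (auto simp: Ric_warped Hess_base grad_tensor_fibre metr_warped u assms(6) algebra_simps)
    also have "\<dots> \<longleftrightarrow> (\<exists>\<mu>. (\<forall>(c, p)\<in>?P. \<forall>v w. ?E c p v w = 0) \<and>
      (\<forall>(d, q)\<in>?Q. \<forall>v w. ?R d q v w = \<mu> * metr F g\<^sub>F d q v w) \<and> (\<forall>(c, p)\<in>?P. ?K c p = \<mu>))"
      by (rule separate_tensor_equation[of _ _ _ _ _ d0 q0 v0 w0 c0 p0])
         (use cp dq nz zeroB zeroF u assms(3,6) in auto)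
    finally have tensor: "(\<forall>e\<in>atlas M. \<forall>z\<in>fst e. \<forall>v w. Ric M g e z v w + Hess M g (h\<^sub>B \<circ> fst) e z v w
        - \<theta> * grad_tensor M (u \<circ> snd) e z v w = lam * metr M g e z v w) \<longleftrightarrow>
      (\<exists>\<mu>. (\<forall>c\<in>atlas B. \<forall>p\<in>fst c. \<forall>v w. ?EB c p v w = lam * metr B g\<^sub>B c p v w) \<and>
        (\<forall>d\<in>atlas F. \<forall>q\<in>fst d. \<forall>v w. ?R d q v w = \<mu> * metr F g\<^sub>F d q v w) \<and>
        (\<forall>c\<in>atlas B. \<forall>p\<in>fst c. ?K c p = \<mu>))"
      by auto
    have harmonic: "(\<forall>e\<in>atlas M. \<forall>z\<in>fst e. Laplace M g (u \<circ> snd) e z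
        - grad_prod M g (u \<circ> snd) (h\<^sub>B \<circ> fst) e z = 0) \<longleftrightarrow>
      (\<forall>d\<in>atlas F. \<forall>q\<in>fst d. Laplace F g\<^sub>F u d q = 0)"
      unfolding ball_atlas_prod using cp f_pos
      by (fastforce simp: Laplace_fibre grad_prod_fibre_base u assms(6))
    show "GRHS M g (h\<^sub>B \<circ> fst) (u \<circ> snd) lam \<theta> \<longleftrightarrow>
         (\<exists>\<mu>.
            (\<forall>c\<in>atlas B. \<forall>p\<in>fst c. \<forall>v w. ?EB c p v w = lam * metr B g\<^sub>B c p v w) \<and>
            einstein_harmonic F g\<^sub>F \<theta> u \<mu> \<and> (\<forall>c\<in>atlas B. \<forall>p\<in>fst c. ?K c p = \<mu>))"
      unfolding GRHS_def einstein_harmonic_def tensor harmonic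
      using semi_riemannian_warped smooth_fun_base[OF smB smF] smooth_fun_fibre[OF smB smF] u assms(5,6)
      by blast
  qed
qed

end
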